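(* Let $G$ be a 2-graph. Then there is a finite sequence of edge refinements, starting from $G$, whose result is an Eulerian graph, i.e. a graph in which every vertex has even degree.
   Context: All graphs are finite simple graphs. For a vertex $x$ of a graph $G$, the unit sphere $S(x)$ is the subgraph of $G$ induced by the neighbors of $x$. A 2-graph is a finite simple graph in which every unit sphere $S(x)$ is a cyclic graph $C_n$ with $n \geq 4$ vertices. An edge refinement of a graph $G=(V,E)$ at an edge $(a,b)\in E$ produces the graph with vertex set $V\cup\{c\}$ ($c$ a new vertex) and edge set $(E\setminus\{(a,b)\})\cup\{(a,c),(c,b)\}\cup\{(c,u) : u \in S(a)\cap S(b)\}$. A sequence of edge refinements means each step is an edge refinement of the graph produced by the previous step (edge refinement of a 2-graph is again a 2-graph). *)

theory Defs
  imports "Graph_Theory.Graph_Theory"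
begin

text \<open>
  Finite simple graphs are the \<^locale>\<open>pair_graph\<close>s: finite, symmetric and loop-free
  digraphs without parallel arcs. An undirected edge \<open>{a, b}\<close> is the pair of arcs
  \<open>(a, b)\<close> and \<open>(b, a)\<close>, so the degree of a vertex is its out-degree.
\<close>

definition unit_sphere :: "'a pair_pre_digraph \<Rightarrow> 'a \<Rightarrow> ('a, 'a \<times> 'a) pre_digraph" where
  "unit_sphere G x = induce_subgraph (with_proj G) {y. (x, y) \<in> parcs G}"

text \<open>This is the cycle \<open>C\<^sub>n\<close> only for \<open>n \<ge> 3\<close>.\<close>

definition cycle_graph :: "nat \<Rightarrow> nat pair_pre_digraph" where
  "cycle_graph n = \<lparr> pverts = {..<n},
     parcs = {(i, j). i < n \<and> j < n \<and> (j = Suc i mod n \<or> i = Suc j mod n)} \<rparr>"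

definition two_graph :: "'a pair_pre_digraph \<Rightarrow> bool" where
  "two_graph G \<longleftrightarrow> pair_graph G \<and>
     (\<forall>x\<in>pverts G. \<exists>n\<ge>4. digraph_iso (unit_sphere G x) (with_proj (cycle_graph n)))"

text \<open>
  \<^const>\<open>subdivide\<close> replaces the edge \<open>{a, b}\<close> by \<open>{a, c}\<close> and \<open>{c, b}\<close>.
  A refinement also joins \<open>c\<close> to the common neighbours of \<open>a\<close> and \<open>b\<close> in \<open>G\<close>.
\<close>

definition edge_refine :: "'a pair_pre_digraph \<Rightarrow> 'a \<Rightarrow> 'a \<Rightarrow> 'a \<Rightarrow> 'a pair_pre_digraph" where
  "edge_refine G a b c =
     (let U = verts (unit_sphere G a) \<inter> verts (unit_sphere G b);
          G' = subdivide G (a, b) c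
      in \<lparr> pverts = pverts G', parcs = parcs G' \<union> {c} \<times> U \<union> U \<times> {c} \<rparr>)"

definition edge_refinement :: "'a pair_pre_digraph \<Rightarrow> 'a pair_pre_digraph \<Rightarrow> bool" where
  "edge_refinement G H \<longleftrightarrow>
     (\<exists>a b c. (a, b) \<in> parcs G \<and> c \<notin> pverts G \<and> H = edge_refine G a b c)"

text \<open>No connectedness is required, and no closed Euler trail is asserted.\<close>

definition eulerian_graph :: "'a pair_pre_digraph \<Rightarrow> bool" where
  "eulerian_graph G \<longleftrightarrow>
     pair_graph G \<and> (\<forall>v\<in>pverts G. even (out_degree (with_proj G) v))"

end

theory Submission
  imports Defs
begin

text \<open>
  Refining the edge \<open>{a, b}\<close> changes exactly the parities of the two common neighbours of \<open>a\<close> and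
  \<open>b\<close>. Refining all edges of \<open>G\<close> once, in any order, creates new vertices of even degree only. In
  a triangle \<open>pqs\<close> whose edge \<open>pq\<close> is refined first, the new vertex on \<open>pq\<close> becomes adjacent to
  the new vertices on \<open>ps\<close> and \<open>qs\<close>; these two inner edges have the opposite pairs \<open>{p, s}\<close> and
  \<open>{q, s}\<close>. No two inner edges lie in a common triangle, so they can be refined independently, and
  the parities of any two adjacent vertices of \<open>G\<close>, hence of any two vertices in one component, can
  be flipped together. By the handshake lemma each component contains an even number of odd vertices.

  All that is needed of a 2-graph is that each edge has exactly two common neighbours and that there
  is no \<open>K\<^sub>4\<close>. Unlike the cyclicity of the unit spheres, this is easily seen to be preserved.
\<close>

section \<open>Links and edge refinements\<close>

text \<open>The link in the sense of simplicial complexes. Taking a vertex set instead of an ordered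
  pair makes it independent of the orientation of an edge.\<close>

definition link :: "'a rel \<Rightarrow> 'a set \<Rightarrow> 'a set" where
  "link E e = {x. \<forall>y\<in>e. (y, x) \<in> E}"

definition odd_verts :: "'a rel \<Rightarrow> 'a set" where
  "odd_verts E = {v. odd (card (E `` {v}))}"

definition edges :: "'a rel \<Rightarrow> 'a set set" where
  "edges E = {{x, y} | x y. (x, y) \<in> E}"

text \<open>In terms of unit spheres: each is a disjoint union of cycles of length at least four.
  The last conjunct excludes \<open>K\<^sub>4\<close>, that is, triangles in a unit sphere.\<close>

definition surface :: "'a rel \<Rightarrow> bool" where
  "surface E \<longleftrightarrow> finite E \<and> sym E \<and> irrefl E \<and> (\<forall>e\<in>edges E. card (link E e) = 2)
     \<and> (\<forall>e\<in>edges E. \<forall>u\<in>link E e. \<forall>v\<in>link E e. (u, v) \<notin> E)"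

definition surface_graph :: "'a pair_pre_digraph \<Rightarrow> bool" where
  "surface_graph G \<longleftrightarrow>
     finite (pverts G) \<and> parcs G \<subseteq> pverts G \<times> pverts G \<and> surface (parcs G)"

text \<open>The arcs of \<open>edge_refine\<close>, with the ends of the refined edge and its common
  neighbours treated alike as the neighbours \<open>W\<close> of \<open>c\<close>.\<close>

definition refine_arcs :: "'a rel \<Rightarrow> 'a \<Rightarrow> 'a \<Rightarrow> 'a \<Rightarrow> 'a rel" where
  "refine_arcs E a b c = (let W = {a, b} \<union> link E {a, b} in
     E - {(a, b), (b, a)} \<union> {c} \<times> W \<union> W \<times> {c})"

lemma link_iff: "x \<in> link E {a, b} \<longleftrightarrow> (a, x) \<in> E \<and> (b, x) \<in> E"
  by (auto simp: link_def)

lemma edgesE: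
  assumes "e \<in> edges E"
  obtains x y where "e = {x, y}" "(x, y) \<in> E"
  using assms by (auto simp: edges_def)

lemma edges_iff: "sym E \<Longrightarrow> {x, y} \<in> edges E \<longleftrightarrow> (x, y) \<in> E"
  by (auto simp: edges_def doubleton_eq_iff sym_def)

lemma surfaceI:
  assumes "finite E" "sym E" "irrefl E"
    and "\<And>x y. (x, y) \<in> E \<Longrightarrow> card (link E {x, y}) = 2"
    and "\<And>x y u v. \<lbrakk>(x, y) \<in> E; (x, u) \<in> E; (x, v) \<in> E; (y, u) \<in> E; (y, v) \<in> E; (u, v) \<in> E\<rbrakk> \<Longrightarrow> False"
  shows "surface E"
  unfolding surface_def edges_def
proof (intro conjI ballI assms(1-3))
  fix e assume "e \<in> {{x, y} |x y. (x, y) \<in> E}"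
  then obtain x y where e: "e = {x, y}" "(x, y) \<in> E" by blast
  show "card (link E e) = 2" unfolding e(1) by (rule assms(4)[OF e(2)])
  fix u v assume "u \<in> link E e" "v \<in> link E e"
  then show "(u, v) \<notin> E" using assms(5)[OF e(2)] unfolding e(1) link_iff by blast
qed

lemma surfaceD:
  assumes "surface E"
  shows "finite E" "sym E" "irrefl E"
    and "(x, y) \<in> E \<Longrightarrow> (y, x) \<in> E" "(x, x) \<notin> E"
    and "(x, y) \<in> E \<Longrightarrow> card (link E {x, y}) = 2"
    and "\<lbrakk>(x, y) \<in> E; (x, u) \<in> E; (x, v) \<in> E; (y, u) \<in> E; (y, v) \<in> E\<rbrakk> \<Longrightarrow> (u, v) \<notin> E"
proof -
  have E: "{x, y} \<in> edges E" if "(x, y) \<in> E" for x y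
    using that by (auto simp: edges_def)
  show "finite E" "sym E" "irrefl E" using assms by (simp_all add: surface_def)
  then show "(x, y) \<in> E \<Longrightarrow> (y, x) \<in> E" "(x, x) \<notin> E"
    by (simp_all add: sym_def irrefl_def)
  show "(x, y) \<in> E \<Longrightarrow> card (link E {x, y}) = 2"
    using assms E by (simp add: surface_def)
  show "\<lbrakk>(x, y) \<in> E; (x, u) \<in> E; (x, v) \<in> E; (y, u) \<in> E; (y, v) \<in> E\<rbrakk> \<Longrightarrow> (u, v) \<notin> E"
    using assms E unfolding surface_def by (meson link_iff)
qed

lemma surface_linkE:
  assumes "surface E" "(a, b) \<in> E"
  obtains u v where "link E {a, b} = {u, v}" "u \<noteq> v" "(a, u) \<in> E" "(b, u) \<in> E" "(a, v) \<in> E"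
    "(b, v) \<in> E" "(u, v) \<notin> E"
proof -
  obtain u v where uv: "link E {a, b} = {u, v}" "u \<noteq> v"
    using surfaceD(6)[OF assms] by (auto simp: card_2_iff)
  then have "(a, u) \<in> E" "(b, u) \<in> E" "(a, v) \<in> E" "(b, v) \<in> E"
    by (metis insertI1 insertI2 link_iff)+
  with uv show ?thesis
    using that surfaceD(7)[OF assms] by blast
qed

section \<open>Effect of one refinement on links and degrees\<close>

lemma edge_refine_conv:
  "pverts (edge_refine G a b c) = insert c (pverts G)"
  "parcs (edge_refine G a b c) = refine_arcs (parcs G) a b c"
  by (auto simp: edge_refine_def Let_def subdivide.simps unit_sphere_def refine_arcs_def link_def)

lemma refine_arcs_iff:
  assumes "c \<notin> Field E"
  shows "(x, y) \<in> refine_arcs E a b c \<longleftrightarrow>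
    (x, y) \<in> E \<and> {x, y} \<noteq> {a, b}
    \<or> x = c \<and> y \<in> {a, b} \<union> link E {a, b} \<or> y = c \<and> x \<in> {a, b} \<union> link E {a, b}"
  unfolding refine_arcs_def Let_def by (auto simp: doubleton_eq_iff)

text \<open>The link of \<open>{x, y}\<close> gains \<open>c\<close> only if \<open>x\<close> and
  \<open>y\<close> both become neighbours of \<open>c\<close>. It loses a vertex only if
  \<open>{a, b}\<close> is another side of a triangle on \<open>{x, y}\<close>, and then one of
  \<open>x\<close>, \<open>y\<close> is an end of \<open>{a, b}\<close> and the other lies in its
  link.\<close>

lemma link_refine_arcs_other:
  assumes "surface E" "(a, b) \<in> E" "c \<notin> Field E" "(x, y) \<in> E"
    and "\<not> {x, y} \<subseteq> {a, b} \<union> link E {a, b}"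
  shows "link (refine_arcs E a b c) {x, y} = link E {x, y}"
proof -
  have fresh: "(c, z) \<notin> E" "(z, c) \<notin> E" for z using assms(3) by (auto simp: Field_def)
  have sym: "(p, q) \<in> E \<longleftrightarrow> (q, p) \<in> E" for p q using surfaceD(4)[OF assms(1)] by blast
  have "(x, z) \<in> refine_arcs E a b c \<and> (y, z) \<in> refine_arcs E a b c \<longleftrightarrow> (x, z) \<in> E \<and> (y, z) \<in> E" for z
  proof (cases "z = c")
    case True
    then show ?thesis using assms(4,5) fresh by (auto simp: refine_arcs_iff[OF assms(3)])
  next
    case False
    have xy: "x \<noteq> c" "y \<noteq> c" using assms(4) fresh by blast+
    have "{x, z} \<noteq> {a, b} \<and> {y, z} \<noteq> {a, b}" if "(x, z) \<in> E" "(y, z) \<in> E"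
    proof (rule ccontr)
      assume "\<not> ?thesis"
      then have "x \<in> {a, b} \<and> y \<in> link E {a, b} \<or> y \<in> {a, b} \<and> x \<in> link E {a, b}"
        using that assms(4) sym[of x y] sym[of z] by (auto simp: link_iff doubleton_eq_iff)
      with assms(5) show False by blast
    qed
    with False xy show ?thesis unfolding refine_arcs_iff[OF assms(3)] by blast
  qed
  then show ?thesis by (simp add: set_eq_iff link_iff)
qed

text \<open>The neighbours of \<open>c\<close> form the 4-cycle \<open>a u b v\<close>, so every
  edge at \<open>c\<close> has two common neighbours. An edge of this 4-cycle exchanges the opposite
  end of \<open>{a, b}\<close> for \<open>c\<close> in its link, and all other links stay as they
  were.\<close>

lemma surface_refine_arcs:
  assumes S: "surface E" and ab: "(a, b) \<in> E" and c: "c \<notin> Field E"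
  shows "surface (refine_arcs E a b c)"
proof -
  let ?E = "refine_arcs E a b c"
  note D = surfaceD[OF S]
  obtain u v where uv: "link E {a, b} = {u, v}" "u \<noteq> v" "(a, u) \<in> E" "(b, u) \<in> E" "(a, v) \<in> E"
    "(b, v) \<in> E" "(u, v) \<notin> E"
    using surface_linkE[OF S ab] .
  have nc: "(c, x) \<notin> E" "(x, c) \<notin> E" for x using c by (auto simp: Field_def)
  have ne: "a \<noteq> b" "a \<noteq> u" "a \<noteq> v" "b \<noteq> u" "b \<noteq> v" "c \<noteq> a" "c \<noteq> b" "c \<noteq> u" "c \<noteq> v"
    using uv ab D(5) nc by metis+
  have iff: "(x, y) \<in> ?E \<longleftrightarrow> (x, y) \<in> E \<and> {x, y} \<noteq> {a, b}
      \<or> x = c \<and> y \<in> {a, b, u, v} \<or> y = c \<and> x \<in> {a, b, u, v}" for x y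
    using refine_arcs_iff[OF c, of x y a b] uv(1) by auto
  have sy: "(x, y) \<in> E \<longleftrightarrow> (y, x) \<in> E" for x y using D(4) by blast
  have old: "card (link ?E {p, q}) = 2 \<and> card (link ?E {q, p}) = 2"
    if p: "p \<in> {a, b}" and q: "q \<in> {u, v}" for p q
  proof -
    obtain p' where p': "{p, p'} = {a, b}" using p by auto
    have pq: "(p, q) \<in> E" and p'L: "p' \<in> link E {p, q}"
      using p q p' uv ab sy ne by (auto simp: link_iff doubleton_eq_iff)
    have "link ?E {p, q} = insert c (link E {p, q} - {p'})"
      using p q p' ne nc by (auto simp: link_iff iff doubleton_eq_iff)
    moreover have "c \<notin> link E {p, q}" using nc by (auto simp: link_iff)
    ultimately have "card (link ?E {p, q}) = 2"
      using D(6)[OF pq] p'L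
      by (metis Diff_iff One_nat_def Suc_1 card.infinite card_Suc_Diff1 card_insert_disjoint
          finite_Diff zero_neq_numeral)
    then show ?thesis by (simp add: insert_commute)
  qed
  have new: "card (link ?E {c, q}) = 2 \<and> card (link ?E {q, c}) = 2"
    if q: "q \<in> {a, b, u, v}" for q
  proof -
    have "link ?E {c, q} = (if q \<in> {a, b} then {u, v} else {a, b})"
      using q ne nc uv(3-7) sy D(5) ab by (auto simp: link_iff iff doubleton_eq_iff)
    then show ?thesis using uv(2) ne(1) by (simp add: insert_commute)
  qed
  show ?thesis
  proof (rule surfaceI)
    show "finite ?E" using D(1) uv(1) by (simp add: refine_arcs_def)
    show "sym ?E" using sy by (auto simp: sym_def iff doubleton_eq_iff)
    show "irrefl ?E" using D(5) ne by (auto simp: irrefl_def iff)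
  next
    fix x y assume xy: "(x, y) \<in> ?E"
    show "card (link ?E {x, y}) = 2"
    proof -
      consider "x = c" | "y = c" | "x \<noteq> c" "y \<noteq> c" "{x, y} \<subseteq> {a, b, u, v}"
        | "x \<noteq> c" "y \<noteq> c" "\<not> {x, y} \<subseteq> {a, b, u, v}"
        by blast
      then show ?thesis
      proof cases
        case 1
        then have "y \<in> {a, b, u, v}" using xy ne nc by (auto simp: iff)
        with 1 new show ?thesis by blast
      next
        case 2
        then have "x \<in> {a, b, u, v}" using xy ne nc by (auto simp: iff)
        with 2 new show ?thesis by blast
      next
        case 3
        have E: "(x, y) \<in> E" "{x, y} \<noteq> {a, b}" using xy 3 by (auto simp: iff)
        then have "x \<noteq> y" "{x, y} \<noteq> {u, v}" using D(4,5) uv(7) by (metis doubleton_eq_iff)+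
        then have "x \<in> {a, b} \<and> y \<in> {u, v} \<or> y \<in> {a, b} \<and> x \<in> {u, v}"
          using 3(3) E(2) by auto
        then show ?thesis using old by blast
      next
        case 4
        with xy have "(x, y) \<in> E" by (auto simp: iff)
        with 4 show ?thesis
          using link_refine_arcs_other[OF S ab c] D(6) uv(1) by auto
      qed
    qed
  next
    \<comment> \<open>Among the neighbours of \<open>c\<close> the graph is bipartite with classes
      \<open>{a, b}\<close> and \<open>{u, v}\<close>: the edge between \<open>a\<close> and
      \<open>b\<close> is gone, and \<open>u\<close>, \<open>v\<close> were never adjacent.\<close>
    have notri: "(p, q) \<notin> ?E"
      if "x \<in> {a, b, u, v}" "p \<in> {a, b, u, v}" "q \<in> {a, b, u, v}" "(x, p) \<in> ?E" "(x, q) \<in> ?E"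
      for x p q
    proof -
      have "(s, t) \<in> ?E \<Longrightarrow> s \<in> {a, b} \<longleftrightarrow> t \<in> {u, v}"
        if "s \<in> {a, b, u, v}" "t \<in> {a, b, u, v}" for s t
        using that ne uv(7) sy D(5) by (auto simp: iff doubleton_eq_iff)
      then show ?thesis using that ne by blast
    qed
    have nbr: "x \<in> {a, b, u, v}" if "(c, x) \<in> ?E \<or> (x, c) \<in> ?E" for x
      using that nc ne by (auto simp: iff)
    have E: "(x, y) \<in> E" if "(x, y) \<in> ?E" "x \<noteq> c" "y \<noteq> c" for x y
      using that by (auto simp: iff)
    fix x y p q
    assume *: "(x, y) \<in> ?E" "(x, p) \<in> ?E" "(x, q) \<in> ?E" "(y, p) \<in> ?E" "(y, q) \<in> ?E" "(p, q) \<in> ?E"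
    \<comment> \<open>In a \<open>K\<^sub>4\<close> containing \<open>c\<close>, the other three
      vertices would form a triangle of neighbours of \<open>c\<close>.\<close>
    consider "x = c" | "y = c" | "p = c" | "q = c" | "c \<notin> {x, y, p, q}" by blast
    then show False
    proof cases
      case 1 then show ?thesis using notri[of y p q] nbr * by blast
    next
      case 2 then show ?thesis using notri[of x p q] nbr * by blast
    next
      case 3 then show ?thesis using notri[of x y q] nbr * by blast
    next
      case 4 then show ?thesis using notri[of x y p] nbr * by blast
    next
      case 5 then show ?thesis using D(7)[of x y p q] E * by blast
    qed
  qed
qed

text \<open>Each of \<open>a\<close> and \<open>b\<close> exchanges the other for \<open>c\<close>,
  the two common neighbours gain \<open>c\<close>, and \<open>c\<close> itself has degree
  four.\<close>

lemma odd_verts_refine_arcs: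
  assumes S: "surface E" and ab: "(a, b) \<in> E" and c: "c \<notin> Field E"
  shows "odd_verts (refine_arcs E a b c) = sym_diff (odd_verts E) (link E {a, b})"
proof -
  let ?E = "refine_arcs E a b c"
  note D = surfaceD[OF S]
  obtain u v where uv: "link E {a, b} = {u, v}" "u \<noteq> v" "(a, u) \<in> E" "(b, u) \<in> E" "(a, v) \<in> E"
    "(b, v) \<in> E" "(u, v) \<notin> E"
    using surface_linkE[OF S ab] .
  have nc: "(c, x) \<notin> E" "(x, c) \<notin> E" for x using c by (auto simp: Field_def)
  have ne: "a \<noteq> b" "a \<noteq> u" "a \<noteq> v" "b \<noteq> u" "b \<noteq> v" "c \<noteq> a" "c \<noteq> b" "c \<noteq> u" "c \<noteq> v"
    using uv ab D(5) nc by metis+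
  have iff: "(x, y) \<in> ?E \<longleftrightarrow> (x, y) \<in> E \<and> {x, y} \<noteq> {a, b}
      \<or> x = c \<and> y \<in> {a, b, u, v} \<or> y = c \<and> x \<in> {a, b, u, v}" for x y
    using refine_arcs_iff[OF c, of x y a b] uv(1) by auto
  have fin: "finite (E `` {x})" for x using D(1) by (simp add: finite_Image)
  have swap: "card (insert c (E `` {x} - {y})) = card (E `` {x})" if "(x, y) \<in> E" for x y
  proof -
    have "card (E `` {x}) = Suc (card (E `` {x} - {y}))"
      using that fin card.remove by (metis Image_singleton_iff)
    with nc fin show ?thesis by (simp add: card_insert_if)
  qed
  have "odd (card (?E `` {x})) \<longleftrightarrow> odd (card (E `` {x})) \<noteq> (x \<in> {u, v})" for x
  proof -
    consider "x = c" | "x = a" | "x = b" | "x = u \<or> x = v" | "x \<notin> {c, a, b, u, v}" by blast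
    then show ?thesis
    proof cases
      case 1
      then have "?E `` {x} = {a, b, u, v}" "E `` {x} = {}" using nc ne by (auto simp: iff)
      with 1 ne uv(2) show ?thesis by simp
    next
      case 2
      then have "?E `` {x} = insert c (E `` {x} - {b})" using nc ne by (auto simp: iff doubleton_eq_iff)
      with 2 ne swap[of a b] ab show ?thesis by simp
    next
      case 3
      then have "?E `` {x} = insert c (E `` {x} - {a})" using nc ne by (auto simp: iff doubleton_eq_iff)
      with 3 ne swap[of b a] D(4)[OF ab] show ?thesis by simp
    next
      case 4
      then have "?E `` {x} = insert c (E `` {x})" using nc ne by (auto simp: iff doubleton_eq_iff)
      with 4 nc fin show ?thesis by (auto simp: card_insert_if)
    next
      case 5
      then have "?E `` {x} = E `` {x}" using nc ne by (auto simp: iff doubleton_eq_iff)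
      with 5 show ?thesis by auto
    qed
  qed
  with uv(1) show ?thesis by (auto simp: odd_verts_def)
qed

lemma surface_graph_edge_refine:
  assumes "surface_graph G" "(a, b) \<in> parcs G" "c \<notin> pverts G"
  shows "surface_graph (edge_refine G a b c)"
proof -
  have G: "finite (pverts G)" "parcs G \<subseteq> pverts G \<times> pverts G" "surface (parcs G)"
    using assms(1) by (auto simp: surface_graph_def)
  have F: "c \<notin> Field (parcs G)" using G(2) assms(3) by (auto simp: Field_def)
  have "link (parcs G) {a, b} \<subseteq> pverts G" "a \<in> pverts G" "b \<in> pverts G"
    using G(2) assms(2) by (auto simp: link_def)
  then have "refine_arcs (parcs G) a b c \<subseteq> insert c (pverts G) \<times> insert c (pverts G)"
    unfolding refine_arcs_def Let_def using G(2) by blast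
  then show ?thesis
    unfolding surface_graph_def edge_refine_conv
    using G(1) surface_refine_arcs[OF G(3) assms(2) F] by blast
qed

lemma surface_graph_edge_refinement:
  assumes "edge_refinement G H" "surface_graph G"
  shows "surface_graph H"
proof -
  obtain a b c where "(a, b) \<in> parcs G" "c \<notin> pverts G" and H: "H = edge_refine G a b c"
    using assms(1) unfolding edge_refinement_def by (elim exE conjE)
  then show ?thesis unfolding H by (intro surface_graph_edge_refine assms(2))
qed

lemma pair_graph_surface_graph:
  assumes "surface_graph G"
  shows "pair_graph G"
proof -
  have "surface (parcs G)" using assms by (simp add: surface_graph_def)
  note D = surfaceD[OF this]
  have V: "finite (pverts G)" "parcs G \<subseteq> pverts G \<times> pverts G"
    using assms by (auto simp: surface_graph_def)
  show ?thesis
  proof unfold_locales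
    fix e assume "e \<in> parcs G"
    then have "(fst e, snd e) \<in> parcs G" by simp
    with V(2) D(5) show "fst e \<in> pverts G" "snd e \<in> pverts G" "fst e \<noteq> snd e"
      by (blast, blast, metis)
  qed (use V D(1,2) in \<open>simp_all add: symmetric_def\<close>)
qed

lemma eulerian_surface_graph:
  assumes "surface_graph G" "odd_verts (parcs G) = {}"
  shows "eulerian_graph G"
proof -
  have "out_arcs (with_proj G) v = Pair v ` (parcs G `` {v})" for v
    by (auto simp: out_arcs_def)
  then have "out_degree (with_proj G) v = card (parcs G `` {v})" for v
    by (simp add: out_degree_def card_image inj_on_def)
  then show ?thesis
    using assms pair_graph_surface_graph by (auto simp: eulerian_graph_def odd_verts_def)
qed

section \<open>From cyclic unit spheres to surfaces\<close>

lemma cycle_graph_nbrs: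
  assumes "n \<ge> 4" "i < n"
  shows "{j. (i, j) \<in> parcs (cycle_graph n)} = {Suc i mod n, (i + n - 1) mod n}"
proof -
  \<comment> \<open>The summand \<open>n\<close> keeps the predecessor correct at
    \<open>i = 0\<close>, where natural subtraction would truncate.\<close>
  have "i = Suc j mod n \<longleftrightarrow> j = (i + n - 1) mod n" if "j < n" for j
    using assms that by (cases "Suc j = n"; cases "i = 0") (auto simp: mod_if)
  with assms show ?thesis by (auto simp: cycle_graph_def)
qed

lemma cycle_graph_no_triangle:
  assumes "n \<ge> 4" "(i, j) \<in> parcs (cycle_graph n)" "(j, k) \<in> parcs (cycle_graph n)"
  shows "(i, k) \<notin> parcs (cycle_graph n)"
  using assms by (auto simp: cycle_graph_def mod_if split: if_splits)

text \<open>The common neighbours of \<open>x\<close> and \<open>y\<close> are the neighbours of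
  \<open>y\<close> in the unit sphere of \<open>x\<close>, hence two in number. A
  \<open>K\<^sub>4\<close> through \<open>x\<close> would give a triangle in that cycle, whose
  length is at least four.\<close>

lemma two_graph_imp_surface_graph:
  assumes "two_graph G"
  shows "surface_graph G"
proof -
  interpret pair_graph G using assms by (simp add: two_graph_def)
  let ?E = "parcs G"
  \<comment> \<open>The digraph isomorphism is reduced to a bijection \<open>\<phi>\<close> of
    vertices that preserves and reflects adjacency.\<close>
  have sphere: "\<exists>n \<phi>. n \<ge> 4 \<and> inj_on \<phi> (?E `` {x}) \<and> \<phi> ` (?E `` {x}) = {..<n} \<and>
      (\<forall>y\<in>?E `` {x}. \<forall>z\<in>?E `` {x}. (\<phi> y, \<phi> z) \<in> parcs (cycle_graph n) \<longleftrightarrow> (y, z) \<in> ?E)"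
    if x: "x \<in> pverts G" for x
  proof -
    let ?S = "unit_sphere G x"
    obtain n f where n: "n \<ge> 4" and f: "pre_digraph.digraph_isomorphism ?S f"
      and eq: "with_proj (cycle_graph n) = app_iso f ?S"
      using assms x unfolding two_graph_def digraph_iso_def by blast
    have S: "verts ?S = ?E `` {x}"
      "arcs_ends ?S = {(y, z). y \<in> ?E `` {x} \<and> z \<in> ?E `` {x} \<and> (y, z) \<in> ?E}"
      by (auto simp: unit_sphere_def arcs_ends_conv)
    have inj: "inj_on (iso_verts f) (?E `` {x})"
      using f S(1) by (metis pre_digraph.digraph_isomorphism_inj_on_verts)
    have "wf_digraph ?S" using f by (simp add: pre_digraph.digraph_isomorphism_def)
    then have "parcs (cycle_graph n)
        = (\<lambda>(u, v). (iso_verts f u, iso_verts f v)) ` arcs_ends ?S"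
      using wf_digraph.arcs_ends_app_iso_eq[OF _ f] eq by (metis with_proj_simps(3))
    then have "(iso_verts f y, iso_verts f z) \<in> parcs (cycle_graph n) \<longleftrightarrow> (y, z) \<in> ?E"
      if "y \<in> ?E `` {x}" "z \<in> ?E `` {x}" for y z
      using that inj unfolding S(2) by (auto dest: inj_onD)
    moreover have "iso_verts f ` (?E `` {x}) = {..<n}"
      using arg_cong[OF eq, of verts] S(1) by (simp add: cycle_graph_def)
    ultimately show ?thesis using n inj by blast
  qed
  have "surface ?E"
  proof (rule surfaceI)
    show "finite ?E" by (rule pair_finite_arcs)
    show "sym ?E" by (rule symI) (rule arcs_symmetric)
    show "irrefl ?E" by (rule irreflI) (metis no_loops')
  next
    fix x y assume xy: "(x, y) \<in> ?E"
    from sphere[OF in_arcsD1[OF xy]] obtain n \<phi> where n: "n \<ge> 4"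
      and \<phi>: "inj_on \<phi> (?E `` {x})" "\<phi> ` (?E `` {x}) = {..<n}"
        "\<forall>y\<in>?E `` {x}. \<forall>z\<in>?E `` {x}. (\<phi> y, \<phi> z) \<in> parcs (cycle_graph n) \<longleftrightarrow> (y, z) \<in> ?E"
      by (elim exE conjE)
    have \<phi>y: "(\<phi> y, \<phi> z) \<in> parcs (cycle_graph n) \<longleftrightarrow> (y, z) \<in> ?E" if "(x, z) \<in> ?E" for z
      using \<phi>(3) xy that by blast
    have y: "\<phi> y < n" using xy \<phi>(2) by blast
    have sub: "link ?E {x, y} \<subseteq> ?E `` {x}" by (auto simp: link_iff)
    have "\<phi> ` link ?E {x, y} = {j. (\<phi> y, j) \<in> parcs (cycle_graph n)}"
    proof (intro equalityI subsetI)
      fix j assume "j \<in> \<phi> ` link ?E {x, y}"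
      then show "j \<in> {j. (\<phi> y, j) \<in> parcs (cycle_graph n)}"
        using \<phi>y by (auto simp: link_iff)
    next
      fix j assume j: "j \<in> {j. (\<phi> y, j) \<in> parcs (cycle_graph n)}"
      then have "j < n" by (simp add: cycle_graph_def)
      then obtain z where z: "z \<in> ?E `` {x}" "j = \<phi> z" using \<phi>(2) by blast
      with j \<phi>y[of z] have "z \<in> link ?E {x, y}" by (auto simp: link_iff)
      with z show "j \<in> \<phi> ` link ?E {x, y}" by blast
    qed
    then have "\<phi> ` link ?E {x, y} = {Suc (\<phi> y) mod n, (\<phi> y + n - 1) mod n}"
      using cycle_graph_nbrs[OF n y] by simp
    moreover have "Suc (\<phi> y) mod n \<noteq> (\<phi> y + n - 1) mod n" using n y by (auto simp: mod_if)
    then have "card {Suc (\<phi> y) mod n, (\<phi> y + n - 1) mod n} = 2" by simp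
    ultimately show "card (link ?E {x, y}) = 2"
      using card_image[OF inj_on_subset[OF \<phi>(1) sub]] by simp
  next
    fix x y u v
    assume *: "(x, y) \<in> ?E" "(x, u) \<in> ?E" "(x, v) \<in> ?E" "(y, u) \<in> ?E" "(y, v) \<in> ?E" "(u, v) \<in> ?E"
    from sphere[OF in_arcsD1[OF *(1)]] obtain n \<phi> where n: "n \<ge> 4"
      and \<phi>: "\<forall>y\<in>?E `` {x}. \<forall>z\<in>?E `` {x}. (\<phi> y, \<phi> z) \<in> parcs (cycle_graph n) \<longleftrightarrow> (y, z) \<in> ?E"
      by (elim exE conjE)
    show False
      using cycle_graph_no_triangle[OF n, of "\<phi> y" "\<phi> u" "\<phi> v"] \<phi> * by blast
  qed
  then show ?thesis
    using pair_finite_verts wellformed' by (auto simp: surface_graph_def)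
qed

section \<open>Flipping parities\<close>

lemma even_card_sym_irrefl:
  assumes "finite E" "sym E" "irrefl E"
  shows "even (card E)"
  using assms
proof (induction E rule: finite_psubset_induct)
  case (psubset E)
  show ?case
  proof (cases "E = {}")
    case False
    then obtain x y where xy: "(x, y) \<in> E" by auto
    then have yx: "(y, x) \<in> E" "x \<noteq> y"
      using psubset.prems by (auto simp: sym_def irrefl_def)
    let ?E = "E - {(x, y), (y, x)}"
    have "even (card ?E)"
      using psubset.prems xy by (intro psubset.IH) (auto simp: sym_def irrefl_def)
    moreover have "card E = card ?E + 2"
      using psubset.hyps xy yx card_mono[of E "{(x, y), (y, x)}"] by (subst card_Diff_subset) auto
    ultimately show ?thesis by simp
  qed simp
qed

text \<open>Handshake lemma for a union \<open>K\<close> of components. The arcs starting in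
  \<open>K\<close> form a symmetric relation because \<open>K\<close> is closed under adjacency, and
  their number is the degree sum over \<open>K\<close>.\<close>

lemma even_card_odd_verts:
  assumes "finite E" "sym E" "irrefl E" "finite K" "\<And>x y. (x, y) \<in> E \<Longrightarrow> x \<in> K \<Longrightarrow> y \<in> K"
  shows "even (card (K \<inter> odd_verts E))"
proof -
  have "E \<inter> K \<times> UNIV = (SIGMA x:K. E `` {x})" by auto
  then have "card (E \<inter> K \<times> UNIV) = (\<Sum>x\<in>K. card (E `` {x}))"
    using assms by (simp add: card_SigmaI finite_Image)
  moreover have "even (card (E \<inter> K \<times> UNIV))"
    using assms by (intro even_card_sym_irrefl) (auto simp: sym_def irrefl_def)
  ultimately have "even (card {x\<in>K. odd (card (E `` {x}))})"
    using even_sum_iff[OF assms(4)] by metis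
  then show ?thesis by (simp add: odd_verts_def Collect_conj_eq)
qed

lemma even_card_sym_diff:
  assumes "finite A" "finite B"
  shows "even (card (sym_diff A B)) \<longleftrightarrow> (even (card A) \<longleftrightarrow> even (card B))"
proof -
  have "card (sym_diff A B) = card (A - B) + card (B - A)"
    using assms by (intro card_Un_disjoint) auto
  moreover have "card A = card (A - B) + card (A \<inter> B)" "card B = card (B - A) + card (A \<inter> B)"
    using card_Int_Diff[OF assms(1), of B] card_Int_Diff[OF assms(2), of A]
    by (simp_all add: Int_commute)
  ultimately show ?thesis by presburger
qed

text \<open>Over the field with two elements, the finite sets meeting every class evenly are spanned
  by the pairs inside classes. A class that meets \<open>A\<close> in \<open>x\<close> must contain
  a second element \<open>y\<close> of \<open>A\<close>; the pair is split off and the rest handled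
  by induction.\<close>

lemma sym_diff_span:
  assumes "finite A" "equiv UNIV R"
    and "{} \<in> B" "\<And>X Y. X \<in> B \<Longrightarrow> Y \<in> B \<Longrightarrow> sym_diff X Y \<in> B"
    and "\<And>x y. (x, y) \<in> R \<Longrightarrow> x \<noteq> y \<Longrightarrow> {x, y} \<in> B"
    and "\<And>x. even (card (R `` {x} \<inter> A))"
  shows "A \<in> B"
  using assms(1,6)
proof (induction A rule: finite_psubset_induct)
  case (psubset A)
  show ?case
  proof (cases "A = {}")
    case False
    then obtain x where x: "x \<in> A" by blast
    have "x \<in> R `` {x} \<inter> A" using x assms(2) by (auto simp: equiv_def refl_on_def)
    then have "R `` {x} \<inter> A \<noteq> {x}" using psubset.prems[of x] by auto
    then obtain y where y: "y \<in> A" "(x, y) \<in> R" "y \<noteq> x" using \<open>x \<in> R `` {x} \<inter> A\<close> by blast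
    have "even (card (R `` {z} \<inter> (A - {x, y})))" for z
    proof -
      \<comment> \<open>Since \<open>x\<close> and \<open>y\<close> are equivalent, each class loses
        both of them or neither, so the parities persist.\<close>
      have "(z, x) \<in> R \<longleftrightarrow> (z, y) \<in> R" using y assms(2) by (meson equivE symE transE)
      then have "R `` {z} \<inter> (A - {x, y})
          = sym_diff (R `` {z} \<inter> A) (if (z, x) \<in> R then {x, y} else {})"
        using x y by auto
      then show ?thesis
        using psubset.prems[of z] psubset.hyps y(3) by (simp add: even_card_sym_diff)
    qed
    then have "A - {x, y} \<in> B" using x by (intro psubset.IH) auto
    then have "sym_diff (A - {x, y}) {x, y} \<in> B" using assms(4,5) y by blast
    moreover have "sym_diff (A - {x, y}) {x, y} = A" using x y by auto
    ultimately show ?thesis by simp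
  qed (simp add: assms(3))
qed

text \<open>The sum modulo two of the links of the edges in \<open>F\<close>: the total parity
  change when the edges of \<open>F\<close> are refined without disturbing each other's links. It is
  linear in \<open>F\<close> with respect to symmetric difference.\<close>

definition flips :: "'a rel \<Rightarrow> 'a set set \<Rightarrow> 'a set" where
  "flips E F = {v. odd (card {e\<in>F. v \<in> link E e})}"

lemma flips_sym_diff:
  assumes "finite F" "finite F'"
  shows "flips E (sym_diff F F') = sym_diff (flips E F) (flips E F')"
proof -
  have "{e \<in> sym_diff F F'. P e} = sym_diff {e\<in>F. P e} {e\<in>F'. P e}" for P by auto
  then show ?thesis using assms by (auto simp: flips_def even_card_sym_diff)
qed

lemma flips_singleton: "flips E {e} = link E e"
proof -
  have "{e' \<in> {e}. v \<in> link E e'} = (if v \<in> link E e then {e} else {})" for v by auto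
  then show ?thesis by (auto simp: flips_def)
qed

lemma flips_insert:
  assumes "finite F" "e \<notin> F"
  shows "flips E (insert e F) = sym_diff (flips E F) (link E e)"
proof -
  have "insert e F = sym_diff F {e}" using assms(2) by auto
  then show ?thesis using assms(1) by (metis finite.emptyI finite.insertI flips_singleton flips_sym_diff)
qed

text \<open>No two edges inside a triangle-free vertex set lie in a common triangle, so refining one of
  them does not change the links of the others.\<close>

lemma eulerian_by_flips:
  assumes "infinite (UNIV :: 'a set)" "finite F"
    and "surface_graph G" "F \<subseteq> edges (parcs G)" "\<Union>F \<subseteq> N" "N \<subseteq> pverts (G :: 'a pair_pre_digraph)"
    and "\<And>x y z. x \<in> N \<Longrightarrow> y \<in> N \<Longrightarrow> z \<in> N \<Longrightarrow>
      (x, y) \<in> parcs G \<Longrightarrow> (x, z) \<in> parcs G \<Longrightarrow> (y, z) \<notin> parcs G"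
    and "odd_verts (parcs G) = flips (parcs G) F"
  shows "\<exists>H. edge_refinement\<^sup>*\<^sup>* G H \<and> eulerian_graph H"
  using assms(2-)
proof (induction F arbitrary: G rule: finite_induct)
  case empty
  then have "eulerian_graph G" by (intro eulerian_surface_graph) (simp_all add: flips_def)
  then show ?case by blast
next
  case (insert e F)
  let ?E = "parcs G"
  have S: "surface ?E" and fin: "finite (pverts G)"
    using insert.prems(1) by (simp_all add: surface_graph_def)
  have "e \<in> edges ?E" using insert.prems(2) by blast
  then obtain a b where e: "e = {a, b}" and ab: "(a, b) \<in> ?E" by (rule edgesE)
  have N: "a \<in> N" "b \<in> N" using insert.prems(3) e by auto
  obtain c where c: "c \<notin> pverts G" using ex_new_if_finite[OF assms(1) fin] by blast
  then have cF: "c \<notin> Field ?E" using insert.prems(1) by (auto simp: surface_graph_def Field_def)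
  have cN: "c \<notin> N" using c insert.prems(4) by blast
  let ?G = "edge_refine G a b c"
  have E': "parcs ?G = refine_arcs ?E a b c" by (rule edge_refine_conv)
  have other: "f \<in> edges (parcs ?G) \<and> link (parcs ?G) f = link ?E f" if "f \<in> F" for f
  proof -
    have "f \<in> edges ?E" using insert.prems(2) that by blast
    then obtain x y where f: "f = {x, y}" and xy: "(x, y) \<in> ?E" by (rule edgesE)
    have "x \<in> N" "y \<in> N" using insert.prems(3) f that by auto
    \<comment> \<open>A common neighbour of \<open>a\<close> and \<open>b\<close> inside
      \<open>N\<close> would complete a triangle in \<open>N\<close>. Hence the only edge within
      \<open>N\<close> whose ends both become neighbours of \<open>c\<close> is
      \<open>{a, b}\<close>.\<close>
    moreover have "z \<notin> N" if "z \<in> link ?E {a, b}" for z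
      using insert.prems(5)[OF N, of z] ab that by (auto simp: link_iff)
    moreover have ne: "{x, y} \<noteq> {a, b}" using insert.hyps(2) that f e by auto
    ultimately have "\<not> {x, y} \<subseteq> {a, b} \<union> link ?E {a, b}"
      using xy surfaceD(5)[OF S, of x] by blast
    moreover have "(x, y) \<in> parcs ?G"
      unfolding E' refine_arcs_iff[OF cF] using xy ne by blast
    ultimately show ?thesis
      unfolding E' f using link_refine_arcs_other[OF S ab cF xy] by (auto simp: edges_def)
  qed
  have "\<exists>H. edge_refinement\<^sup>*\<^sup>* ?G H \<and> eulerian_graph H"
  proof (rule insert.IH)
    show "surface_graph ?G" using surface_graph_edge_refine insert.prems(1) ab c .
    show "F \<subseteq> edges (parcs ?G)" using other by blast
    show "\<Union>F \<subseteq> N" using insert.prems(3) by blast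
    show "N \<subseteq> pverts ?G" using insert.prems(4) by (auto simp: edge_refine_conv)
    have "flips (parcs ?G) F = flips ?E F"
      unfolding flips_def using other by (metis (no_types, lifting) Collect_cong)
    then show "odd_verts (parcs ?G) = flips (parcs ?G) F"
      unfolding E' odd_verts_refine_arcs[OF S ab cF] insert.prems(6) e[symmetric]
      using insert.hyps by (auto simp: flips_insert)
  next
    \<comment> \<open>Every new arc has \<open>c\<close> as an end, and \<open>c\<close> is outside
      \<open>N\<close>, so \<open>N\<close> stays free of triangles.\<close>
    have old: "(x, y) \<in> ?E" if "(x, y) \<in> parcs ?G" "x \<in> N" "y \<in> N" for x y
      using that cN unfolding E' refine_arcs_iff[OF cF] by blast
    fix x y z assume "x \<in> N" "y \<in> N" "z \<in> N" "(x, y) \<in> parcs ?G" "(x, z) \<in> parcs ?G"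
    then show "(y, z) \<notin> parcs ?G" using insert.prems(5)[of x y z] old by metis
  qed
  moreover have "edge_refinement G ?G" using ab c by (auto simp: edge_refinement_def)
  ultimately show ?case by (meson converse_rtranclp_into_rtranclp)
qed

section \<open>Splitting all edges\<close>

text \<open>The edges of \<open>G\<close> are split in the order given by the rank \<open>r\<close>. Vertices of the intermediate
  graphs are encoded by cells of \<open>G\<close>: the singleton \<open>{x}\<close> stands for the old vertex \<open>x\<close>, and an edge
  stands for the vertex splitting it. The edge of a triangle that is split first leads it.\<close>

locale full_subdivision =
  fixes G :: "'a pair_pre_digraph" and r :: "'a set \<Rightarrow> nat" and h :: "'a set \<Rightarrow> 'a"
  assumes surface_graph: "surface_graph G"
    and bij_r: "bij_betw r (edges (parcs G)) {..<card (edges (parcs G))}"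
    and h_vert: "\<And>x. x \<in> pverts G \<Longrightarrow> h {x} = x"
    and inj_h_edges: "inj_on h (edges (parcs G))"
    and h_edge: "\<And>e. e \<in> edges (parcs G) \<Longrightarrow> h e \<notin> pverts G"
begin

abbreviation "E \<equiv> parcs G"
abbreviation "V \<equiv> pverts G"
abbreviation "Es \<equiv> edges E"

section \<open>Cells and the graphs between splittings\<close>

definition tri :: "'a set \<Rightarrow> bool" where
  "tri T \<longleftrightarrow> card T = 3 \<and> (\<forall>x\<in>T. \<forall>y\<in>T. x \<noteq> y \<longrightarrow> (x, y) \<in> E)"

definition leads :: "'a set \<Rightarrow> 'a set \<Rightarrow> bool" where
  "leads e T \<longleftrightarrow> e \<in> Es \<and> e \<subseteq> T \<and> tri T \<and> (\<forall>f\<in>Es. f \<subseteq> T \<longrightarrow> r e \<le> r f)"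

text \<open>The vertices present once the edges of rank below \<open>k\<close> have been
  split.\<close>

definition cells :: "nat \<Rightarrow> 'a set set" where
  "cells k = (\<lambda>x. {x}) ` V \<union> {e \<in> Es. r e < k}"

text \<open>A closed form for the adjacency after \<open>k\<close> splittings. Inclusion joins the
  vertex splitting an edge to the ends of that edge. A split edge leading a triangle is joined to
  the opposite vertex and to the other sides already split. The last disjunct can hold only for two
  singletons and describes the edges not yet split.\<close>

definition adj :: "nat \<Rightarrow> 'a set \<Rightarrow> 'a set \<Rightarrow> bool" where
  "adj k s t \<longleftrightarrow> s \<in> cells k \<and> t \<in> cells k \<and> s \<noteq> t \<and>
     (s \<subset> t \<or> t \<subset> s \<or> leads s (s \<union> t) \<or> leads t (s \<union> t) \<or> s \<union> t \<in> Es \<and> k \<le> r (s \<union> t))"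

definition sd :: "nat \<Rightarrow> 'a pair_pre_digraph" where
  "sd k = \<lparr>pverts = h ` cells k, parcs = {(h s, h t) | s t. adj k s t}\<rparr>"

lemma surface: "surface E"
  using surface_graph by (simp add: surface_graph_def)

lemmas E = surfaceD[OF surface]

lemma E_V: "(x, y) \<in> E \<Longrightarrow> x \<in> V \<and> y \<in> V"
  using surface_graph by (auto simp: surface_graph_def)

lemma Es_iff: "{x, y} \<in> Es \<longleftrightarrow> (x, y) \<in> E"
  by (rule edges_iff[OF E(2)])

lemma EsE:
  assumes "e \<in> Es"
  obtains x y where "e = {x, y}" "(x, y) \<in> E" "x \<noteq> y" "x \<in> V" "y \<in> V"
proof -
  obtain x y where "e = {x, y}" "(x, y) \<in> E" using assms by (rule edgesE)
  then show ?thesis using that E(5) E_V by metis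
qed

lemma card_Es: "e \<in> Es \<Longrightarrow> card e = 2"
  by (erule EsE) simp

lemma finite_Es: "e \<in> Es \<Longrightarrow> finite e"
  by (erule EsE) simp

lemma Es_subset_eq: "e \<in> Es \<Longrightarrow> f \<in> Es \<Longrightarrow> e \<subseteq> f \<Longrightarrow> e = f"
  by (simp add: card_Es card_subset_eq finite_Es)

lemma singleton_notin_Es: "{x} \<notin> Es"
  using card_Es[of "{x}"] by auto

lemma r_eqD: "e \<in> Es \<Longrightarrow> f \<in> Es \<Longrightarrow> r e = r f \<Longrightarrow> e = f"
  using bij_r by (auto simp: bij_betw_def dest: inj_onD)

lemma cellsE:
  assumes "s \<in> cells k"
  obtains (vert) x where "x \<in> V" "s = {x}" | (edge) "s \<in> Es" "r s < k"
  using assms by (auto simp: cells_def)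

lemma cells_Es: "e \<in> Es \<Longrightarrow> e \<in> cells k \<longleftrightarrow> r e < k"
  using singleton_notin_Es by (auto simp: cells_def)

lemma cells_singleton: "x \<in> V \<Longrightarrow> {x} \<in> cells k"
  by (auto simp: cells_def)

lemma inj_h: "inj_on h (cells k)"
proof (rule inj_onI)
  fix s t assume st: "s \<in> cells k" "t \<in> cells k" "h s = h t"
  then show "s = t"
    using h_vert h_edge inj_onD[OF inj_h_edges] by (metis cellsE)
qed

lemma sd_arc_iff:
  assumes "s \<in> cells k" "t \<in> cells k"
  shows "(h s, h t) \<in> parcs (sd k) \<longleftrightarrow> adj k s t"
proof
  assume "(h s, h t) \<in> parcs (sd k)"
  then obtain s' t' where *: "h s = h s'" "h t = h t'" "adj k s' t'" by (auto simp: sd_def)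
  then have "s = s'" "t = t'"
    using assms inj_onD[OF inj_h] unfolding adj_def by metis+
  with * show "adj k s t" by simp
qed (auto simp: sd_def)

lemma adj_sym: "adj k s t \<longleftrightarrow> adj k t s"
  by (auto simp: adj_def Un_commute)

lemma leadsD:
  assumes "leads e T"
  shows "e \<in> Es" "e \<subseteq> T" "tri T" "card T = 3" "f \<in> Es \<Longrightarrow> f \<subseteq> T \<Longrightarrow> r e \<le> r f"
  using assms by (auto simp: leads_def tri_def)

lemma leads_unique: "leads e T \<Longrightarrow> leads f T \<Longrightarrow> e = f"
  by (meson leadsD(1,2,5) le_antisym r_eqD)

lemma not_leads_singleton: "\<not> leads {x} T"
  using leadsD(1) singleton_notin_Es by blast

lemma tri_triple:
  "tri {a, b, c} \<longleftrightarrow> (a, b) \<in> E \<and> (a, c) \<in> E \<and> (b, c) \<in> E"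
proof
  assume T: "tri {a, b, c}"
  then have "a \<noteq> b \<and> a \<noteq> c \<and> b \<noteq> c"
    by (auto simp: tri_def card_insert_if split: if_splits)
  with T show "(a, b) \<in> E \<and> (a, c) \<in> E \<and> (b, c) \<in> E" by (auto simp: tri_def)
next
  assume *: "(a, b) \<in> E \<and> (a, c) \<in> E \<and> (b, c) \<in> E"
  then have "a \<noteq> b" "a \<noteq> c" "b \<noteq> c" using E(5) by metis+
  with * show "tri {a, b, c}" using E(4)[of a b] E(4)[of a c] E(4)[of b c] by (auto simp: tri_def)
qed

lemma tri_leader:
  assumes "(a, b) \<in> E" "(a, c) \<in> E" "(b, c) \<in> E"
  shows "leads {a, b} {a, b, c} \<or> leads {a, c} {a, b, c} \<or> leads {b, c} {a, b, c}"
proof -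
  have "{a, b} \<in> Es \<and> {a, b} \<subseteq> {a, b, c}" using assms by (simp add: Es_iff)
  from ex_has_least_nat[where P = "\<lambda>f. f \<in> Es \<and> f \<subseteq> {a, b, c}", OF this, of r]
  obtain f where f: "f \<in> Es" "f \<subseteq> {a, b, c}" "\<And>g. g \<in> Es \<Longrightarrow> g \<subseteq> {a, b, c} \<Longrightarrow> r f \<le> r g"
    by blast
  then have "leads f {a, b, c}" using assms by (simp add: leads_def tri_triple)
  moreover have "f \<in> {{a, b}, {a, c}, {b, c}}"
    using f(1,2) by (elim EsE) auto
  ultimately show ?thesis by blast
qed

text \<open>Before any splitting all cells are singletons, which neither lead a triangle nor contain
  one another properly, so only the last disjunct of \<open>adj\<close> is left.\<close>

lemma sd_0: "sd 0 = G"
proof -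
  have "h ` cells 0 = V" using h_vert by (auto simp: cells_def image_image)
  moreover have "(x, y) \<in> {(h s, h t) | s t. adj 0 s t} \<longleftrightarrow> (x, y) \<in> E" for x y
  proof
    assume "(x, y) \<in> {(h s, h t) | s t. adj 0 s t}"
    then obtain s t where st: "x = h s" "y = h t" "adj 0 s t" by auto
    then obtain u v where uv: "u \<in> V" "v \<in> V" "s = {u}" "t = {v}"
      unfolding adj_def by (auto elim!: cellsE)
    then have "{u, v} \<in> Es" using st(3) by (auto simp: adj_def not_leads_singleton insert_commute)
    then show "(x, y) \<in> E" using uv st(1,2) by (simp add: Es_iff h_vert)
  next
    assume xy: "(x, y) \<in> E"
    then have "adj 0 {x} {y}" "h {x} = x" "h {y} = y"
      using E_V[OF xy] E(4)[OF xy] E(5)[of x] h_vert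
      by (auto simp: adj_def cells_singleton Es_iff)
    then show "(x, y) \<in> {(h s, h t) | s t. adj 0 s t}" by force
  qed
  then have "{(h s, h t) | s t. adj 0 s t} = E" by auto
  ultimately show ?thesis by (simp add: sd_def)
qed

section \<open>Splitting the edge of rank \<open>k\<close>\<close>

context
  fixes k a b
  assumes ab: "(a, b) \<in> E" and r_ab: "r {a, b} = k"
begin

text \<open>Between old cells only the last disjunct of \<open>adj\<close> depends on
  \<open>k\<close>, and by injectivity of \<open>r\<close> on edges it changes only for the edge
  \<open>{a, b}\<close>.\<close>

lemma adj_Suc_old:
  assumes "s \<in> cells k" "t \<in> cells k"
  shows "adj (Suc k) s t \<longleftrightarrow> adj k s t \<and> {s, t} \<noteq> {{a}, {b}}"
proof -
  have cells: "s \<in> cells (Suc k)" "t \<in> cells (Suc k)" using assms by (auto simp: cells_def)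
  have ab_Es: "{a, b} \<in> Es" using ab by (simp add: Es_iff)
  show ?thesis
  proof (cases "s \<union> t = {a, b}")
    case True
    have single: "\<exists>x. u = {x}" if "u \<in> cells k" "u \<subseteq> {a, b}" for u
      using that(1)
    proof (cases rule: cellsE)
      case edge
      then show ?thesis using Es_subset_eq[OF _ ab_Es that(2)] r_ab by auto
    qed blast
    have "s \<subseteq> {a, b}" "t \<subseteq> {a, b}" using True by auto
    then obtain x y where st: "s = {x}" "t = {y}" using single assms by meson
    have "\<not> adj (Suc k) s t"
    proof
      assume "adj (Suc k) s t"
      then have "s \<subset> t \<or> t \<subset> s \<or> Suc k \<le> r {a, b}"
        unfolding adj_def True using not_leads_singleton st by blast
      then show False using st r_ab by auto
    qed
    moreover have "{s, t} = {{a}, {b}}"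
      using True unfolding st by (auto simp: doubleton_eq_iff)
    ultimately show ?thesis by blast
  next
    case False
    then have "s \<union> t \<in> Es \<and> k \<le> r (s \<union> t) \<longleftrightarrow> s \<union> t \<in> Es \<and> Suc k \<le> r (s \<union> t)"
      using r_eqD[OF _ ab_Es, of "s \<union> t"] r_ab by (auto simp: Suc_le_eq le_less)
    moreover have "{s, t} \<noteq> {{a}, {b}}" using False by (auto simp: doubleton_eq_iff)
    ultimately show ?thesis using assms cells by (simp add: adj_def)
  qed
qed

lemma adj_vert_edge:
  assumes "t \<in> Es" "t \<in> cells k" "x \<in> V"
  shows "adj k {x} t \<longleftrightarrow> x \<in> t \<or> leads t (insert x t)"
proof -
  have "insert x t \<in> Es \<longrightarrow> insert x t = t"
    using Es_subset_eq[OF assms(1), of "insert x t"] by auto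
  moreover have "\<not> t \<subseteq> {x}" using card_Es[OF assms(1)] card_mono[of "{x}" t] by auto
  ultimately show ?thesis
    using assms cells_singleton[OF assms(3)] cells_Es[OF assms(1)]
    by (auto simp: adj_def not_leads_singleton)
qed

text \<open>The neighbours of the new vertex are those an edge refinement prescribes. If
  \<open>t\<close> is a vertex \<open>{x}\<close>, then \<open>{a, b}\<close> leads the triangle on
  \<open>a\<close>, \<open>b\<close>, \<open>x\<close> exactly when the two other sides are present
  and unsplit. If \<open>t\<close> is an edge split earlier, both sides of the equivalence say that
  \<open>t\<close> leads the triangle \<open>{a, b} \<union> t\<close>.\<close>

lemma adj_Suc_new:
  assumes t: "t \<in> cells k"
  shows "adj (Suc k) {a, b} t \<longleftrightarrow> t = {a} \<or> t = {b} \<or> adj k {a} t \<and> adj k {b} t"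
proof -
  have ab_Es: "{a, b} \<in> Es" using ab by (simp add: Es_iff)
  have ne: "a \<noteq> b" using ab E(5) by metis
  have V: "a \<in> V" "b \<in> V" using E_V[OF ab] by auto
  have cells: "t \<in> cells (Suc k)" "{a, b} \<in> cells (Suc k)"
    using t ab_Es r_ab by (auto simp: cells_def)
  show ?thesis
    using t
  proof (cases rule: cellsE)
    case (vert x)
    have x1: "adj (Suc k) {a, b} {x} \<longleftrightarrow> x \<in> {a, b} \<or> leads {a, b} {a, b, x}"
    proof -
      have "{a, b, x} \<in> Es \<longrightarrow> {a, b, x} = {a, b}"
        using Es_subset_eq[OF ab_Es, of "{a, b, x}"] by auto
      then show ?thesis
        using vert cells ne r_ab by (auto simp: adj_def not_leads_singleton insert_commute)
    qed
    have x2: "adj k {y} {x} \<longleftrightarrow> (y, x) \<in> E \<and> k \<le> r {y, x}" if "y \<in> V" for y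
    proof -
      have "{y, x} \<in> Es \<longleftrightarrow> (y, x) \<in> E" by (rule Es_iff)
      then show ?thesis
        using that vert(1) cells_singleton E(5)[of x]
        by (auto simp: adj_def not_leads_singleton insert_commute)
    qed
    have "leads {a, b} {a, b, x} \<longleftrightarrow> (a, x) \<in> E \<and> k \<le> r {a, x} \<and> (b, x) \<in> E \<and> k \<le> r {b, x}"
    proof
      assume L: "leads {a, b} {a, b, x}"
      have "(a, x) \<in> E" "(b, x) \<in> E" using leadsD(3)[OF L] by (simp_all add: tri_triple)
      then show "(a, x) \<in> E \<and> k \<le> r {a, x} \<and> (b, x) \<in> E \<and> k \<le> r {b, x}"
        using leadsD(5)[OF L, of "{a, x}"] leadsD(5)[OF L, of "{b, x}"] r_ab by (auto simp: Es_iff)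
    next
      assume R: "(a, x) \<in> E \<and> k \<le> r {a, x} \<and> (b, x) \<in> E \<and> k \<le> r {b, x}"
      have "r {a, b} \<le> r f" if f: "f \<in> Es" "f \<subseteq> {a, b, x}" for f
      proof -
        have "f \<in> {{a, b}, {a, x}, {b, x}}" using f by (elim EsE) auto
        then show ?thesis using R r_ab by auto
      qed
      then show "leads {a, b} {a, b, x}" using R ab ab_Es by (auto simp: leads_def tri_triple)
    qed
    then show ?thesis using x1 x2 V vert by auto
  next
    case edge
    have t_ne: "t \<noteq> {a, b}" using edge r_ab by auto
    have "{a, b} \<union> t \<in> Es \<longrightarrow> {a, b} \<union> t = {a, b}"
      using Es_subset_eq[OF ab_Es, of "{a, b} \<union> t"] by auto
    then have "adj (Suc k) {a, b} t \<longleftrightarrow>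
        leads {a, b} ({a, b} \<union> t) \<or> leads t ({a, b} \<union> t)"
      using cells t_ne r_ab Es_subset_eq[OF ab_Es edge(1)] Es_subset_eq[OF edge(1) ab_Es]
      by (auto simp: adj_def)
    \<comment> \<open>The edge \<open>t\<close> has smaller rank than \<open>{a, b}\<close>, so
      \<open>{a, b}\<close> cannot lead a triangle containing \<open>t\<close>.\<close>
    also have "\<dots> \<longleftrightarrow> leads t ({a, b} \<union> t)"
      using leadsD(5)[of "{a, b}" "{a, b} \<union> t" t] edge r_ab by force
    also have "\<dots> \<longleftrightarrow> (a \<in> t \<or> leads t (insert a t)) \<and> (b \<in> t \<or> leads t (insert b t))"
    proof
      assume L: "leads t ({a, b} \<union> t)"
      have "a \<in> t \<or> b \<in> t"
      proof (rule ccontr)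
        assume "\<not> ?thesis"
        then have "card ({a, b} \<union> t) = 4"
          using card_Es[OF edge(1)] finite_Es[OF edge(1)] ne by simp
        then show False using leadsD(4)[OF L] by simp
      qed
      then show "(a \<in> t \<or> leads t (insert a t)) \<and> (b \<in> t \<or> leads t (insert b t))"
        using L by (auto simp: insert_absorb insert_commute)
    next
      assume R: "(a \<in> t \<or> leads t (insert a t)) \<and> (b \<in> t \<or> leads t (insert b t))"
      have "a \<in> t \<or> b \<in> t"
      proof (rule ccontr)
        \<comment> \<open>If \<open>t\<close> avoided both \<open>a\<close> and \<open>b\<close>, it
          would span a triangle with each of them, and together they would form a
          \<open>K\<^sub>4\<close>.\<close>
        assume no: "\<not> ?thesis"
        obtain p q where pq: "t = {p, q}" "(p, q) \<in> E" using edge(1) by (rule edgesE)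
        have "tri {a, p, q}" "tri {b, p, q}" using R no leadsD(3) pq(1) by auto
        then have "(p, a) \<in> E" "(p, b) \<in> E" "(q, a) \<in> E" "(q, b) \<in> E"
          by (simp_all add: tri_triple E(4))
        then show False using E(7)[OF pq(2)] ab by blast
      qed
      moreover have "\<not> {a, b} \<subseteq> t" using Es_subset_eq[OF ab_Es edge(1)] t_ne by auto
      ultimately show "leads t ({a, b} \<union> t)"
        using R by (auto simp: insert_absorb insert_commute)
    qed
    finally show ?thesis
      using adj_vert_edge[OF edge(1) t] V edge(1) singleton_notin_Es by auto
  qed
qed

text \<open>The vertex \<open>h {a, b}\<close> is used as the fresh one. Arcs between old cells are
  compared by \<open>adj_Suc_old\<close>, arcs at the new vertex by
  \<open>adj_Suc_new\<close>.\<close>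

lemma edge_refinement_sd: "edge_refinement (sd k) (sd (Suc k))"
proof -
  let ?e = "{a, b}"
  have ab_Es: "?e \<in> Es" using ab by (simp add: Es_iff)
  have V: "a \<in> V" "b \<in> V" using E_V[OF ab] by auto
  have ne: "a \<noteq> b" using ab E(5) by metis
  have ha: "h {a} = a" "h {b} = b" using V h_vert by auto
  have rk: "r e = k \<longleftrightarrow> e = ?e" if "e \<in> Es" for e
    using r_eqD[OF that ab_Es] unfolding r_ab by (metis r_ab)
  have "{e \<in> Es. r e < Suc k} = insert ?e {e \<in> Es. r e < k}"
    unfolding less_Suc_eq using rk ab_Es by blast
  then have cells: "{a} \<in> cells k" "{b} \<in> cells k" "cells (Suc k) = insert ?e (cells k)"
    using V by (auto simp: cells_def)
  have e_new: "?e \<notin> cells k" using cells_Es[OF ab_Es] r_ab by simp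
  have arc: "(a, b) \<in> parcs (sd k)"
    using sd_arc_iff[OF cells(1,2)] cells ne ab_Es r_ab ha
    by (simp add: adj_def insert_commute)
  have h_eq: "h s = h t \<longleftrightarrow> s = t" if "s \<in> cells (Suc k)" "t \<in> cells (Suc k)" for s t
    using that inj_on_eq_iff[OF inj_h] by blast
  have new: "h ?e \<notin> pverts (sd k)"
  proof
    assume "h ?e \<in> pverts (sd k)"
    then obtain s where "s \<in> cells k" "h ?e = h s" by (auto simp: sd_def)
    then show False using h_eq cells(3) e_new by blast
  qed
  have F: "h ?e \<notin> Field (parcs (sd k))"
  proof -
    have "Field (parcs (sd k)) \<subseteq> pverts (sd k)" by (auto simp: Field_def sd_def adj_def)
    with new show ?thesis by blast
  qed
  let ?R = "refine_arcs (parcs (sd k)) a b (h ?e)"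
  have nbr: "h t \<in> {a, b} \<union> link (parcs (sd k)) {a, b} \<longleftrightarrow> adj (Suc k) ?e t"
    if t: "t \<in> cells k" for t
  proof -
    have "h t = a \<longleftrightarrow> t = {a}" "h t = b \<longleftrightarrow> t = {b}"
      using h_eq[of t "{a}"] h_eq[of t "{b}"] t cells ha by auto
    moreover have "h t \<in> link (parcs (sd k)) {a, b} \<longleftrightarrow> adj k {a} t \<and> adj k {b} t"
      using sd_arc_iff[OF cells(1) t] sd_arc_iff[OF cells(2) t] ha by (simp add: link_iff)
    ultimately show ?thesis using adj_Suc_new[OF t] by blast
  qed
  have not_nbr: "h ?e \<notin> {a, b} \<union> link (parcs (sd k)) {a, b}"
    using new arc F V h_edge[OF ab_Es] by (auto simp: link_iff Field_def)
  have R_iff: "(h s, h t) \<in> ?R \<longleftrightarrow> adj (Suc k) s t"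
    if st: "s \<in> cells (Suc k)" "t \<in> cells (Suc k)" for s t
  proof -
    consider "s = ?e" "t = ?e" | "s = ?e" "t \<in> cells k" | "s \<in> cells k" "t = ?e"
      | "s \<in> cells k" "t \<in> cells k"
      using st cells(3) by blast
    then show ?thesis
    proof cases
      case 1
      then show ?thesis using not_nbr F by (auto simp: refine_arcs_iff[OF F] adj_def Field_def)
    next
      case 2
      then have "h t \<noteq> h s" using h_eq st e_new by metis
      with 2 show ?thesis using nbr[of t] F by (auto simp: refine_arcs_iff[OF F] Field_def)
    next
      case 3
      then have "h t \<noteq> h s" using h_eq st e_new by metis
      with 3 show ?thesis using nbr[of s] F adj_sym[of "Suc k" s t]
        by (auto simp: refine_arcs_iff[OF F] Field_def)
    next
      case 4
      then have "h s \<noteq> h ?e" "h t \<noteq> h ?e" using h_eq st e_new cells(3) by (metis insertI1)+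
      moreover have "{h s, h t} = {a, b} \<longleftrightarrow> {s, t} = {{a}, {b}}"
        using h_eq[of _ "{a}"] h_eq[of _ "{b}"] st cells ha by (auto simp: doubleton_eq_iff)
      ultimately show ?thesis
        using adj_Suc_old[OF 4] sd_arc_iff[OF 4] by (simp add: refine_arcs_iff[OF F])
    qed
  qed
  have "pverts (edge_refine (sd k) a b (h ?e)) = pverts (sd (Suc k))"
    by (simp add: edge_refine_conv sd_def cells(3))
  moreover have "?R = parcs (sd (Suc k))"
  proof (intro equalityI subrelI)
    fix x y assume xy: "(x, y) \<in> ?R"
    \<comment> \<open>All arcs of \<open>?R\<close> join names of cells, so \<open>R_iff\<close>
      applies to each of them.\<close>
    have sub: "parcs (sd k) \<subseteq> h ` cells k \<times> h ` cells k" by (auto simp: sd_def adj_def)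
    then have "{a, b} \<union> link (parcs (sd k)) {a, b} \<subseteq> h ` cells k"
      using arc unfolding link_def by blast
    with sub have "?R \<subseteq> insert (h ?e) (h ` cells k) \<times> insert (h ?e) (h ` cells k)"
      unfolding refine_arcs_def Let_def by blast
    then have "x \<in> h ` cells (Suc k)" "y \<in> h ` cells (Suc k)"
      using xy unfolding cells(3) by auto
    then obtain s t where "x = h s" "y = h t" "s \<in> cells (Suc k)" "t \<in> cells (Suc k)"
      by (elim imageE)
    then show "(x, y) \<in> parcs (sd (Suc k))" using xy R_iff sd_arc_iff by metis
  next
    fix x y assume "(x, y) \<in> parcs (sd (Suc k))"
    then obtain s t where "x = h s" "y = h t" "adj (Suc k) s t" by (auto simp: sd_def)
    then show "(x, y) \<in> ?R" using R_iff by (metis adj_def)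
  qed
  ultimately have "sd (Suc k) = edge_refine (sd k) a b (h ?e)"
    by (intro pair_pre_digraph.equality) (simp_all add: edge_refine_conv)
  then show ?thesis using arc new by (auto simp: edge_refinement_def)
qed

end

section \<open>The fully split graph\<close>

abbreviation "D \<equiv> parcs (sd (card Es))"

lemma r_less: "e \<in> Es \<Longrightarrow> r e < card Es"
  using bij_r by (auto simp: bij_betw_def)

lemma edge_cell: "e \<in> Es \<Longrightarrow> e \<in> cells (card Es)"
  by (simp add: cells_Es r_less)

lemma edge_refinements_sd:
  "k \<le> card Es \<Longrightarrow> edge_refinement\<^sup>*\<^sup>* G (sd k) \<and> surface_graph (sd k)"
proof (induction k)
  case 0
  then show ?case by (simp add: sd_0 surface_graph)
next
  case (Suc k)
  have "k \<in> r ` Es" using bij_r Suc.prems by (auto simp: bij_betw_def)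
  then obtain e where e: "e \<in> Es" "r e = k" by auto
  from e(1) obtain a b where "e = {a, b}" "(a, b) \<in> E" by (rule edgesE)
  then have "edge_refinement (sd k) (sd (Suc k))" using edge_refinement_sd e(2) by simp
  then show ?case
    using Suc surface_graph_edge_refinement by (meson Suc_leD rtranclp.rtrancl_into_rtrancl)
qed

lemma surface_graph_sd: "surface_graph (sd (card Es))"
  using edge_refinements_sd by simp

lemma surface_D: "surface D"
  using surface_graph_sd by (simp add: surface_graph_def)

text \<open>Two distinct edges whose union has only three vertices share one of them, here
  \<open>p\<close>.\<close>

lemma leads_shape:
  assumes "leads e (e \<union> f)" "f \<in> Es"
  obtains p a b where "e = {p, a}" "f = {p, b}" "a \<noteq> b" "(p, a) \<in> E" "(p, b) \<in> E" "(a, b) \<in> E"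
proof -
  obtain x y where e: "e = {x, y}" "x \<noteq> y" using leadsD(1)[OF assms(1)] by (rule EsE)
  obtain u v where f: "f = {u, v}" "u \<noteq> v" using assms(2) by (rule EsE)
  have card: "card {x, y, u, v} = 3" using leadsD(4)[OF assms(1)] e f by (simp add: insert_commute)
  have "e \<noteq> f" using leadsD(4)[OF assms(1)] card_Es[OF assms(2)] by auto
  then have ef: "{x, y} \<noteq> {u, v}" using e f by simp
  have "x = u \<or> x = v \<or> y = u \<or> y = v"
  proof (rule ccontr)
    assume "\<not> ?thesis"
    then show False using card e(2) f(2) by simp
  qed
  then have "\<exists>p a b. {x, y} = {p, a} \<and> {u, v} = {p, b} \<and> a \<noteq> b"
  proof (elim disjE)
    assume "x = u" then show ?thesis
      using ef by (intro exI[of _ x] exI[of _ y] exI[of _ v]) auto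
  next
    assume "x = v" then show ?thesis
      using ef by (intro exI[of _ x] exI[of _ y] exI[of _ u]) auto
  next
    assume "y = u" then show ?thesis
      using ef by (intro exI[of _ y] exI[of _ x] exI[of _ v]) auto
  next
    assume "y = v" then show ?thesis
      using ef by (intro exI[of _ y] exI[of _ x] exI[of _ u]) auto
  qed
  then obtain p a b where pab: "e = {p, a}" "f = {p, b}" "a \<noteq> b"
    unfolding e(1) f(1) by (elim exE conjE)
  moreover have "e \<union> f = {p, a, b}" using pab by auto
  then have "tri {p, a, b}" using leadsD(3)[OF assms(1)] by simp
  ultimately show ?thesis using that by (simp add: tri_triple)
qed

text \<open>All ranks are below \<open>card Es\<close>, so no unsplit edge is left. The condition
  that \<open>s\<close> and \<open>t\<close> differ is implied, since an edge has two vertices and a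
  triangle three.\<close>

lemma adj_card_Es:
  "adj (card Es) s t \<longleftrightarrow> s \<in> cells (card Es) \<and> t \<in> cells (card Es) \<and>
     (s \<subset> t \<or> t \<subset> s \<or> leads s (s \<union> t) \<or> leads t (s \<union> t))"
proof -
  have "\<not> leads s s" using leadsD(1,4)[of s s] card_Es[of s] by auto
  then show ?thesis using r_less[of "s \<union> t"] by (auto simp: adj_def)
qed

lemma adj_edges:
  assumes "adj (card Es) e f" "e \<in> Es" "f \<in> Es" "r e \<le> r f"
  shows "leads e (e \<union> f)"
proof -
  have "e \<noteq> f" using assms(1) by (simp add: adj_def)
  moreover have "leads e (e \<union> f) \<or> leads f (e \<union> f)"
    using assms(1) Es_subset_eq[OF assms(2,3)] Es_subset_eq[OF assms(3,2)]
    unfolding adj_card_Es by blast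
  moreover have "r f \<le> r e" if "leads f (e \<union> f)" using leadsD(5)[OF that assms(2)] by simp
  ultimately show ?thesis using r_eqD[OF assms(2,3)] assms(4) by fastforce
qed

text \<open>Write \<open>e = {p, a}\<close> and \<open>f = {p, b}\<close>. If \<open>f\<close> and
  \<open>g\<close> meet in \<open>p\<close>, then \<open>p\<close> and the other ends of
  \<open>e\<close>, \<open>f\<close>, \<open>g\<close> form a \<open>K\<^sub>4\<close>. If they meet
  in \<open>b\<close>, then \<open>e\<close>, \<open>f\<close>, \<open>g\<close> are the sides of
  one triangle, led by both \<open>e\<close> and \<open>f\<close>.\<close>

lemma no_leads_triangle:
  assumes "leads e (e \<union> f)" "leads e (e \<union> g)" "leads f (f \<union> g)" "g \<in> Es"
  shows False
proof -
  have fE: "f \<in> Es" using leadsD(1)[OF assms(3)] .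
  obtain p a b where ef: "e = {p, a}" "f = {p, b}" "a \<noteq> b" "(p, a) \<in> E" "(p, b) \<in> E" "(a, b) \<in> E"
    using leads_shape[OF assms(1) fE] .
  obtain q c d where fg: "f = {q, c}" "g = {q, d}" "c \<noteq> d" "(q, c) \<in> E" "(q, d) \<in> E" "(c, d) \<in> E"
    using leads_shape[OF assms(3,4)] .
  have "q = p \<and> c = b \<or> q = b \<and> c = p" using ef(2) fg(1) by (auto simp: doubleton_eq_iff)
  then show False
  proof
    assume q: "q = p \<and> c = b"
    have "e \<union> g = {p, a, d}" using ef fg q by auto
    then have "(a, d) \<in> E" using leadsD(3)[OF assms(2)] by (simp add: tri_triple)
    then show False using E(7)[OF ef(4), of b d] ef fg q by blast
  next
    assume q: "q = b \<and> c = p"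
    have "e \<union> g = {p, a, b, d}" using ef fg q by auto
    moreover have "p \<noteq> a" "p \<noteq> b" "d \<noteq> b" using ef fg q E(5) by metis+
    ultimately have "d = a" using leadsD(4)[OF assms(2)] ef(3) fg(3) q
      by (auto simp: card_insert_if split: if_splits)
    then have "e \<subseteq> f \<union> g" using ef fg q by auto
    then have "r f \<le> r e" using leadsD(5)[OF assms(3)] leadsD(1)[OF assms(1)] by blast
    moreover have "r e \<le> r f" using leadsD(5)[OF assms(1) fE] by simp
    ultimately have "e = f" using r_eqD[OF leadsD(1)[OF assms(1)] fE] by simp
    then show False using ef(1-3) by (auto simp: doubleton_eq_iff)
  qed
qed

text \<open>This makes the set of new vertices a legitimate \<open>N\<close> in
  \<open>eulerian_by_flips\<close>. Of three pairwise adjacent split edges, each would lead the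
  triangles it spans with the later ones.\<close>

lemma no_triangle_new:
  assumes "x \<in> h ` Es" "y \<in> h ` Es" "z \<in> h ` Es" "(x, y) \<in> D" "(x, z) \<in> D"
  shows "(y, z) \<notin> D"
proof
  assume "(y, z) \<in> D"
  obtain e f g where e: "x = h e" "e \<in> Es" and f: "y = h f" "f \<in> Es" and g: "z = h g" "g \<in> Es"
    using assms(1-3) by (elim imageE)
  have adj: "adj (card Es) e f" "adj (card Es) e g" "adj (card Es) f g"
    using assms(4,5) \<open>(y, z) \<in> D\<close> e f g sd_arc_iff edge_cell by metis+
  \<comment> \<open>By symmetry of \<open>adj\<close> the three edges may be taken in order of
    rank.\<close>
  have sorted: False
    if "adj (card Es) e f" "adj (card Es) e g" "adj (card Es) f g" "e \<in> Es" "f \<in> Es" "g \<in> Es"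
      "r e \<le> r f" "r f \<le> r g" for e f g
    using that no_leads_triangle[of e f g] adj_edges[of e f] adj_edges[of e g] adj_edges[of f g] by simp
  consider "r e \<le> r f" "r f \<le> r g" | "r e \<le> r g" "r g \<le> r f" | "r f \<le> r e" "r e \<le> r g"
    | "r f \<le> r g" "r g \<le> r e" | "r g \<le> r e" "r e \<le> r f" | "r g \<le> r f" "r f \<le> r e"
    by linarith
  then show False
    using sorted e(2) f(2) g(2) adj adj_sym by cases blast+
qed

text \<open>Besides the two ends of \<open>e\<close>, each of the two triangles on \<open>e\<close>
  contributes an odd number of neighbours: three if \<open>e\<close> leads it, and only the leader
  otherwise.\<close>

lemma even_degree_new:
  assumes "e \<in> Es"
  shows "h e \<notin> odd_verts D"
proof -
  let ?n = "card Es"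
  obtain a b where e: "e = {a, b}" and ab: "(a, b) \<in> E" "a \<noteq> b" "a \<in> V" "b \<in> V"
    using assms by (rule EsE)
  obtain u v where uv: "link E {a, b} = {u, v}" "u \<noteq> v" "(a, u) \<in> E" "(b, u) \<in> E"
    "(a, v) \<in> E" "(b, v) \<in> E" "(u, v) \<notin> E"
    using surface_linkE[OF surface ab(1)] .
  \<comment> \<open>The neighbours of \<open>e\<close> that come from the triangle on
    \<open>a\<close>, \<open>b\<close>, \<open>w\<close>.\<close>
  define P where "P w = {t \<in> cells ?n. e \<union> t = {a, b, w} \<and> (leads e {a, b, w} \<or> leads t {a, b, w})}" for w
  have P: "finite (P w) \<and> odd (card (P w))" if w: "(a, w) \<in> E" "(b, w) \<in> E" for w
  proof -
    have ne: "w \<noteq> a" "w \<noteq> b" using w E(5) by metis+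
    have edges: "{a, w} \<in> Es" "{b, w} \<in> Es" using w by (simp_all add: Es_iff)
    have "t \<in> {{w}, {a, w}, {b, w}}" if "t \<in> cells ?n" "e \<union> t = {a, b, w}" for t
      using that(1)
    proof (cases rule: cellsE)
      case (vert x)
      then show ?thesis using that(2) ne e by auto
    next
      case edge
      have "w \<in> t" "t \<subseteq> {a, b, w}" using that(2) ne e by auto
      then show ?thesis using edge(1) by (elim EsE) auto
    qed
    moreover have "{w} \<in> cells ?n" "{a, w} \<in> cells ?n" "{b, w} \<in> cells ?n"
      using E_V[OF w(1)] cells_singleton edge_cell edges by auto
    ultimately have P_eq: "P w = {t \<in> {{w}, {a, w}, {b, w}}. leads e {a, b, w} \<or> leads t {a, b, w}}"
      unfolding P_def e by blast
    have distinct: "e \<noteq> {a, w}" "e \<noteq> {b, w}" "{a, w} \<noteq> {b, w}" "{w} \<noteq> {a, w}" "{w} \<noteq> {b, w}"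
      using ne ab(2) e by (auto simp: doubleton_eq_iff)
    consider "leads e {a, b, w}" | "leads {a, w} {a, b, w}" | "leads {b, w} {a, b, w}"
      using tri_leader[OF ab(1) w] e by blast
    then show ?thesis
    proof cases
      case 1
      then have "P w = {{w}, {a, w}, {b, w}}" unfolding P_eq by blast
      then show ?thesis using distinct by simp
    next
      case 2
      then have "P w = {{a, w}}"
        unfolding P_eq using leads_unique distinct not_leads_singleton by blast
      then show ?thesis by simp
    next
      case 3
      then have "P w = {{b, w}}"
        unfolding P_eq using leads_unique distinct not_leads_singleton by blast
      then show ?thesis by simp
    qed
  qed
  have "{t. adj ?n e t} = {{a}, {b}} \<union> (P u \<union> P v)"
  proof (intro equalityI subsetI)
    fix t assume "t \<in> {t. adj ?n e t}"
    then have t: "t \<in> cells ?n" "e \<subset> t \<or> t \<subset> e \<or> leads e (e \<union> t) \<or> leads t (e \<union> t)"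
      by (auto simp: adj_card_Es)
    have no: "\<not> e \<subset> t"
      using t(1)
    proof (cases rule: cellsE)
      case (vert x)
      then show ?thesis using e ab(2) by auto
    next
      case edge
      then show ?thesis using Es_subset_eq[OF assms, of t] by auto
    qed
    show "t \<in> {{a}, {b}} \<union> (P u \<union> P v)"
    proof (cases "t \<subset> e")
      case True
      have "t \<noteq> {}" using t(1) singleton_notin_Es card_Es[of t] by (auto elim: cellsE)
      then have "t = {a} \<or> t = {b}" using True e by auto
      then show ?thesis by blast
    next
      case False
      then have L: "leads e (e \<union> t) \<or> leads t (e \<union> t)" using t no by blast
      then have T: "tri (e \<union> t)" using leadsD(3) by blast
      have "\<exists>w. e \<union> t = {a, b, w}"
      proof -
        have "card (e \<union> t) = Suc (card e)" using T card_Es[OF assms] by (simp add: tri_def)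
        moreover have "finite (e \<union> t)" using calculation by (metis card.infinite nat.distinct(1))
        ultimately have "card (e \<union> t - e) = 1" using finite_Es[OF assms] by (simp add: card_Diff_subset)
        then obtain w where "e \<union> t - e = {w}" by (auto simp: card_1_singleton_iff)
        then have "e \<union> t = {a, b, w}" using e by blast
        then show ?thesis ..
      qed
      then obtain w where w: "e \<union> t = {a, b, w}" ..
      then have "w \<in> link E {a, b}" using T by (simp add: tri_triple link_iff)
      then have "w = u \<or> w = v" using uv(1) by auto
      then show ?thesis using t(1) w L unfolding P_def by auto
    qed
  next
    fix t assume "t \<in> {{a}, {b}} \<union> (P u \<union> P v)"
    then show "t \<in> {t. adj ?n e t}"
      using ab edge_cell[OF assms] cells_singleton e unfolding P_def by (auto simp: adj_card_Es)
  qed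
  moreover have "P u \<inter> P v = {}"
  proof -
    have "u \<notin> {a, b, v}" using uv E(5) by (metis insert_iff empty_iff)
    then have "{a, b, u} \<noteq> {a, b, v}" by blast
    then show ?thesis unfolding P_def by auto
  qed
  moreover have "{{a}, {b}} \<inter> (P u \<union> P v) = {}"
  proof -
    have "u \<notin> {a, b}" "v \<notin> {a, b}" using uv E(5) by (metis insert_iff empty_iff)+
    then show ?thesis unfolding P_def e by auto
  qed
  moreover have fin: "finite (P u)" "finite (P v)" using P uv by simp_all
  ultimately have "card {t. adj ?n e t} = card {{a}, {b}} + (card (P u) + card (P v))"
    using card_Un_disjoint[of "{{a}, {b}}" "P u \<union> P v"] card_Un_disjoint[OF fin] by simp
  moreover have "D `` {h e} = h ` {t. adj ?n e t}"
  proof (intro equalityI subsetI)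
    fix y assume "y \<in> D `` {h e}"
    then obtain s t where st: "h s = h e" "y = h t" "adj ?n s t" by (auto simp: sd_def)
    then have "s = e"
      using inj_onD[OF inj_h, of s e] edge_cell[OF assms] unfolding adj_def by blast
    then show "y \<in> h ` {t. adj ?n e t}" using st by blast
  qed (auto simp: sd_def)
  moreover have "inj_on h {t. adj ?n e t}"
    using inj_h by (rule inj_on_subset) (auto simp: adj_def)
  ultimately show ?thesis
    using P uv ab(2) by (simp add: odd_verts_def card_image)
qed

section \<open>Parity changes realised by inner edges\<close>

definition flip_sets :: "'a set set" where
  "flip_sets = flips D ` {F. F \<subseteq> edges D \<and> \<Union>F \<subseteq> h ` Es}"

lemma finite_edges_D: "finite (edges D)"
proof -
  have "edges D = (\<lambda>(x, y). {x, y}) ` D" by (auto simp: edges_def)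
  then show ?thesis using surfaceD(1)[OF surface_D] by simp
qed

lemma flip_sets_sym_diff:
  assumes "X \<in> flip_sets" "Y \<in> flip_sets"
  shows "sym_diff X Y \<in> flip_sets"
proof -
  obtain F F' where F: "F \<subseteq> edges D" "\<Union>F \<subseteq> h ` Es" "X = flips D F"
    and F': "F' \<subseteq> edges D" "\<Union>F' \<subseteq> h ` Es" "Y = flips D F'"
    using assms by (auto simp: flip_sets_def)
  have "sym_diff X Y = flips D (sym_diff F F')"
    using F F' finite_edges_D flips_sym_diff by (metis finite_subset)
  moreover have "sym_diff F F' \<subseteq> edges D" "\<Union>(sym_diff F F') \<subseteq> h ` Es" using F F' by blast+
  ultimately show ?thesis unfolding flip_sets_def by blast
qed

text \<open>The inner edge between the vertices splitting \<open>{p, q}\<close> and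
  \<open>{p, s}\<close> has \<open>p\<close> and \<open>s\<close> as common neighbours. It has
  exactly two, so refining it flips just these.\<close>

lemma flip_sets_leader:
  assumes L: "leads {p, q} {p, q, s}"
  shows "{p, s} \<in> flip_sets"
proof -
  let ?n = "card Es"
  have T: "(p, q) \<in> E" "(p, s) \<in> E" "(q, s) \<in> E" using leadsD(3)[OF L] by (simp_all add: tri_triple)
  have ne: "p \<noteq> q" "p \<noteq> s" "q \<noteq> s" using T E(5) by metis+
  have V: "p \<in> V" "s \<in> V" "h {p} = p" "h {s} = s" using E_V[OF T(2)] h_vert by auto
  have Es: "{p, q} \<in> Es" "{p, s} \<in> Es" using T by (simp_all add: Es_iff)
  have un: "{p, q} \<union> {p, s} = {p, q, s}" "{p, q} \<union> {s} = {p, q, s}" by auto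
  note cells = edge_cell[OF Es(1)] edge_cell[OF Es(2)] cells_singleton[OF V(1), of ?n]
    cells_singleton[OF V(2), of ?n]
  have "adj ?n {p, q} {p, s}" "adj ?n {p, q} {p}" "adj ?n {p, q} {s}" "adj ?n {p, s} {p}"
    "adj ?n {p, s} {s}"
    unfolding adj_card_Es using cells L un ne by auto
  then have D: "(h {p, q}, h {p, s}) \<in> D" "(h {p, q}, p) \<in> D" "(h {p, q}, s) \<in> D"
    "(h {p, s}, p) \<in> D" "(h {p, s}, s) \<in> D"
    using sd_arc_iff cells V(3,4) by metis+
  then have "{p, s} \<subseteq> link D {h {p, q}, h {p, s}}" by (simp add: link_iff)
  moreover have card: "card (link D {h {p, q}, h {p, s}}) = 2"
    using surfaceD(6)[OF surface_D D(1)] .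
  ultimately have "{p, s} = link D {h {p, q}, h {p, s}}"
    using ne(2) by (intro card_subset_eq) (auto intro: card_ge_0_finite)
  then have "{p, s} = flips D {{h {p, q}, h {p, s}}}" by (simp add: flips_singleton)
  moreover have "{{h {p, q}, h {p, s}}} \<subseteq> edges D" "\<Union>{{h {p, q}, h {p, s}}} \<subseteq> h ` Es"
    using D(1) Es by (auto simp: edges_def)
  ultimately show ?thesis unfolding flip_sets_def by blast
qed

text \<open>The leader \<open>{p, q}\<close> has an inner edge towards each of the other two sides,
  which yields \<open>{p, s}\<close> and \<open>{q, s}\<close>; their symmetric difference is
  \<open>{p, q}\<close>.\<close>

lemma flip_sets_triangle:
  assumes L: "leads {p, q} {p, q, s}" and xy: "x \<in> {p, q, s}" "y \<in> {p, q, s}" "x \<noteq> y"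
  shows "{x, y} \<in> flip_sets"
proof -
  have T: "(p, q) \<in> E" "(p, s) \<in> E" "(q, s) \<in> E" using leadsD(3)[OF L] by (simp_all add: tri_triple)
  have ne: "p \<noteq> q" "p \<noteq> s" "q \<noteq> s" using T E(5) by metis+
  have ps: "{p, s} \<in> flip_sets" using flip_sets_leader[OF L] .
  have qs: "{q, s} \<in> flip_sets" using flip_sets_leader[of q p s] L by (simp add: insert_commute)
  have "sym_diff {p, s} {q, s} = {p, q}" using ne by auto
  then have "{p, q} \<in> flip_sets" using flip_sets_sym_diff[OF ps qs] by simp
  with ps qs xy show ?thesis by (auto simp: insert_commute)
qed

text \<open>Every edge lies in some triangle, and that triangle has a leader.\<close>

lemma flip_sets_adjacent:
  assumes "(x, y) \<in> E"
  shows "{x, y} \<in> flip_sets"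
proof -
  obtain w where w: "(x, w) \<in> E" "(y, w) \<in> E" using surface_linkE[OF surface assms] by metis
  have "x \<noteq> y" using assms E(5) by metis
  have "{x, w, y} = {x, y, w}" "{y, w, x} = {x, y, w}" by auto
  then show ?thesis
    using tri_leader[OF assms w] flip_sets_triangle[of x y w x y] flip_sets_triangle[of x w y x y]
      flip_sets_triangle[of y w x x y] \<open>x \<noteq> y\<close> by auto
qed

lemma flip_sets_connected:
  assumes "(x, y) \<in> E\<^sup>*" "x \<noteq> y"
  shows "{x, y} \<in> flip_sets"
proof -
  \<comment> \<open>Along a path the inner vertices cancel. Writing the pair as a symmetric
    difference makes it empty for the trivial path.\<close>
  have "sym_diff {x} {y} \<in> flip_sets"
    using assms(1)
  proof (induction rule: rtrancl_induct)
    case base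
    have "flips D {} = {}" by (simp add: flips_def)
    then show ?case unfolding flip_sets_def by (force simp: image_iff)
  next
    case (step y z)
    have "y \<noteq> z" using step.hyps(2) E(5) by metis
    then have "sym_diff {y} {z} = {y, z}" by auto
    then have "sym_diff (sym_diff {x} {y}) (sym_diff {y} {z}) \<in> flip_sets"
      using flip_sets_sym_diff[OF step.IH flip_sets_adjacent[OF step.hyps(2)]] by simp
    moreover have "sym_diff (sym_diff {x} {y}) (sym_diff {y} {z}) = sym_diff {x} {z}" by auto
    ultimately show ?case by simp
  qed
  moreover have "sym_diff {x} {y} = {x, y}" using assms(2) by auto
  ultimately show ?thesis by simp
qed

section \<open>Counting odd vertices in components\<close>

lemma odd_verts_D_subset: "odd_verts D \<subseteq> V"
proof
  fix x assume x: "x \<in> odd_verts D"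
  have "x \<in> h ` cells (card Es)"
  proof (rule ccontr)
    assume "x \<notin> h ` cells (card Es)"
    then have "D `` {x} = {}" by (auto simp: sd_def adj_def)
    with x show False by (simp add: odd_verts_def)
  qed
  then obtain s where s: "s \<in> cells (card Es)" "x = h s" by blast
  from s(1) show "x \<in> V"
  proof (cases rule: cellsE)
    case edge
    then show ?thesis using even_degree_new x s(2) by blast
  qed (use s(2) h_vert in auto)
qed

text \<open>Splitting does not merge components: adjacent cells lie in a common edge or triangle of
  \<open>G\<close>.\<close>

lemma adj_component:
  assumes "adj (card Es) s t" "x \<in> s" "y \<in> t"
  shows "(x, y) \<in> E\<^sup>*"
proof -
  have Es_adj: "(p, q) \<in> E" if "e \<in> Es" "p \<in> e" "q \<in> e" "p \<noteq> q" for e p q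
    using that E(4) by (elim EsE) auto
  have cell_adj: "(p, q) \<in> E" if "u \<in> cells (card Es)" "p \<in> u" "q \<in> u" "p \<noteq> q" for u p q
    using that(1)
  proof (cases rule: cellsE)
    case (vert z)
    then show ?thesis using that(2-4) by simp
  next
    case edge
    then show ?thesis using Es_adj that(2-4) by blast
  qed
  have cells: "s \<in> cells (card Es)" "t \<in> cells (card Es)"
    using assms(1) by (simp_all add: adj_def)
  have "s \<subset> t \<or> t \<subset> s \<or> tri (s \<union> t)"
    using assms(1) leadsD(3) unfolding adj_card_Es by blast
  then have "x = y \<or> (x, y) \<in> E"
  proof (elim disjE)
    assume "s \<subset> t"
    then show ?thesis using cell_adj[OF cells(2), of x y] assms(2,3) by blast
  next
    assume "t \<subset> s"
    then show ?thesis using cell_adj[OF cells(1), of x y] assms(2,3) by blast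
  next
    assume "tri (s \<union> t)"
    then show ?thesis using assms(2,3) unfolding tri_def by blast
  qed
  then show ?thesis by blast
qed

lemma even_odd_verts_component: "even (card (E\<^sup>* `` {x} \<inter> odd_verts D))"
proof -
  let ?C = "E\<^sup>* `` {x}" and ?n = "card Es"
  \<comment> \<open>The part of the split graph lying over the component \<open>?C\<close>. It is
    closed under adjacency, so the handshake lemma applies, and its odd vertices are old ones, hence
    in \<open>?C\<close>.\<close>
  let ?K = "h ` {s \<in> cells ?n. s \<inter> ?C \<noteq> {}}"
  have "finite ?K"
  proof -
    have "finite (h ` cells ?n)" using surface_graph_sd by (simp add: surface_graph_def sd_def)
    then show ?thesis by (rule finite_subset[rotated]) blast
  qed
  moreover have "y' \<in> ?K" if xy: "(x', y') \<in> D" "x' \<in> ?K" for x' y'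
  proof -
    obtain s where s: "s \<in> cells ?n" "x' = h s" "s \<inter> ?C \<noteq> {}" using xy(2) by blast
    obtain s' t where t: "x' = h s'" "y' = h t" "adj ?n s' t" using xy(1) by (auto simp: sd_def)
    then have "s' = s" using s inj_onD[OF inj_h] by (metis adj_def)
    obtain p where p: "p \<in> s" "p \<in> ?C" using s(3) by blast
    have "t \<in> cells ?n" using t(3) by (simp add: adj_def)
    then have "t \<noteq> {}" using card_Es[of t] by (auto elim: cellsE)
    then obtain q where q: "q \<in> t" by blast
    have "(p, q) \<in> E\<^sup>*" using adj_component t(3) \<open>s' = s\<close> p(1) q by blast
    then have "q \<in> ?C" using p(2) by (auto intro: rtrancl_trans)
    then show ?thesis using t(2) q \<open>t \<in> cells ?n\<close> by blast
  qed
  ultimately have "even (card (?K \<inter> odd_verts D))"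
    using surfaceD(1-3)[OF surface_D] by (intro even_card_odd_verts)
  moreover have "?K \<inter> odd_verts D = ?C \<inter> odd_verts D"
  proof (intro equalityI subsetI)
    fix y assume y: "y \<in> ?K \<inter> odd_verts D"
    then obtain s where s: "s \<in> cells ?n" "y = h s" "s \<inter> ?C \<noteq> {}" by blast
    have yV: "y \<in> V" using y odd_verts_D_subset by blast
    from s(1) have "s = {y}"
    proof (cases rule: cellsE)
      case edge
      then show ?thesis using h_edge s(2) yV by blast
    qed (use s(2) h_vert in auto)
    then show "y \<in> ?C \<inter> odd_verts D" using s(3) y by blast
  next
    fix y assume y: "y \<in> ?C \<inter> odd_verts D"
    then have "y \<in> V" using odd_verts_D_subset by blast
    then have "{y} \<in> cells ?n" "h {y} = y" using cells_singleton h_vert by auto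
    with y show "y \<in> ?K \<inter> odd_verts D" by (auto intro!: rev_image_eqI[of "{y}"])
  qed
  ultimately show ?thesis by simp
qed

text \<open>Reachability in the symmetric relation \<open>E\<close> is an equivalence. Its classes
  contain evenly many odd vertices, and its pairs can be flipped.\<close>

lemma odd_verts_D_flip_sets: "odd_verts D \<in> flip_sets"
proof (rule sym_diff_span[where R = "E\<^sup>*"])
  have "finite V" using surface_graph by (simp add: surface_graph_def)
  then show "finite (odd_verts D)" using odd_verts_D_subset finite_subset by blast
  show "equiv UNIV (E\<^sup>*)"
    by (intro equivI refl_rtrancl trans_rtrancl sym_rtrancl E(2)) auto
  have "flips D {} = {}" by (simp add: flips_def)
  then show "{} \<in> flip_sets" unfolding flip_sets_def by (force simp: image_iff)
qed (use flip_sets_sym_diff flip_sets_connected even_odd_verts_component in auto)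

lemma eulerian_refinement:
  assumes "infinite (UNIV :: 'a set)"
  shows "\<exists>H. edge_refinement\<^sup>*\<^sup>* G H \<and> eulerian_graph H"
proof -
  obtain F where F: "F \<subseteq> edges D" "\<Union>F \<subseteq> h ` Es" "odd_verts D = flips D F"
    using odd_verts_D_flip_sets by (auto simp: flip_sets_def)
  have "h ` Es \<subseteq> pverts (sd (card Es))" using edge_cell by (auto simp: sd_def)
  then have "\<exists>H. edge_refinement\<^sup>*\<^sup>* (sd (card Es)) H \<and> eulerian_graph H"
    using F no_triangle_new
    by (intro eulerian_by_flips[OF assms finite_subset[OF F(1) finite_edges_D] surface_graph_sd])
  then obtain H where H: "edge_refinement\<^sup>*\<^sup>* (sd (card Es)) H" "eulerian_graph H" by blast
  have "edge_refinement\<^sup>*\<^sup>* G (sd (card Es))" using edge_refinements_sd by simp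
  then show ?thesis using H by (meson rtranclp_trans)
qed

end

section \<open>Choice of the order and of the fresh vertices\<close>

theorem theoremI:
  fixes G :: "'a pair_pre_digraph"
  assumes "infinite (UNIV :: 'a set)"
    and "two_graph G"
  shows "\<exists>H. edge_refinement\<^sup>*\<^sup>* G H \<and> eulerian_graph H"
proof -
  have G: "surface_graph G" using assms(2) by (rule two_graph_imp_surface_graph)
  let ?Es = "edges (parcs G)"
  have finV: "finite (pverts G)" using G by (simp add: surface_graph_def)
  have "?Es = (\<lambda>(x, y). {x, y}) ` parcs G" by (auto simp: edges_def)
  then have finE: "finite ?Es" using G by (simp add: surface_graph_def surface_def)
  obtain r where r: "bij_betw r ?Es {..<card ?Es}"
    using ex_bij_betw_finite_nat[OF finE] by (metis lessThan_atLeast0)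
  have "infinite (UNIV - pverts G)" using assms(1) finV by (simp add: Diff_infinite_finite)
  then obtain B where B: "finite B" "card B = card ?Es" "B \<subseteq> UNIV - pverts G"
    using infinite_arbitrarily_large by blast
  obtain g where g: "bij_betw g ?Es B" using finite_same_card_bij[OF finE B(1)] B(2) by metis
  \<comment> \<open>On a singleton \<open>{x}\<close>, which is never an edge of a loop-free graph,
    \<open>the_elem\<close> returns \<open>x\<close>.\<close>
  define h where "h s = (if s \<in> ?Es then g s else the_elem s)" for s
  have "full_subdivision G r h"
  proof
    show "surface_graph G" by (rule G)
    show "bij_betw r ?Es {..<card ?Es}" by (rule r)
    show "h {x} = x" for x
    proof -
      have "{x} \<notin> ?Es" using surfaceD(5)[of "parcs G"] G by (auto simp: edges_def surface_graph_def)
      then show ?thesis by (simp add: h_def)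
    qed
    show "inj_on h ?Es" using g by (auto simp: h_def bij_betw_def inj_on_def)
    show "h e \<notin> pverts G" if "e \<in> ?Es" for e
      using that g B(3) by (auto simp: h_def bij_betw_def)
  qed
  then show ?thesis by (rule full_subdivision.eulerian_refinement[OF _ assms(1)])
qed

end
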